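(* Consider the four-dimensional Lagrangian $\mathcal N=2$ quiver SCFTs that admit a large-$N$ limit for all gauge algebras: quivers whose shape is the Dynkin diagram of a finite or affine Lie algebra $\mathfrak b$ with bifundamental matter, as well as those with hypermultiplets in (anti-)symmetric representations (see context). At large $N$, the exponential rate $\kappa_i$ associated with decoupling the node with gauge algebra $\mathfrak g_i$ is $$\kappa_i=\kappa_{\min}\sqrt{\frac{\dim\mathfrak g_{\rm tot}}{\dim\mathfrak g_i}},\qquad \kappa_{\min}\ \ge\ \sqrt{\frac12+\frac1{12}\,(2-\lambda_{\max})}\ \ge\ \frac1{\sqrt2}.$$ Here $\lambda_{\max}\le 2$ is the largest eigenvalue of the adjacency matrix $A=2\cdot\mathbf 1-C$, with $C$ the Cartan matrix of $\mathfrak b$: $\lambda_{\max}=2$ if $\mathfrak b$ is affine and $\lambda_{\max}=2\cos(\pi/h_{\mathfrak b})<2$ if $\mathfrak b$ is finite with Coxeter number $h_{\mathfrak b}$. In the presence of (anti-)symmetric representations the bound remains valid with $\lambda_{\max}$ computed from the appropriate doubled algebra (see context). The first bound on $\kappa_{\min}$ is saturated for affine quivers. The bound $\kappa_{\min}\ge\frac1{\sqrt2}$ is saturated by $\mathcal N=4$ super-Yang--Mills and its orientifolds at all values of $N$, while for finite quivers $\kappa_{\min}>\frac1{\sqrt2}$.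
   Context: **Quivers with bifundamental matter.** $\mathfrak b$ is a Lie algebra of finite type $A_r,B_r,C_r,D_r,E_6,E_7,E_8,F_4$ or of affine type $A_r^{(1)},B_r^{(1)},C_r^{(1)},D_r^{(1)},E_{6,7,8}^{(1)},F_4^{(1)},D_{r+1}^{(2)},A_{2r-1}^{(2)},E_6^{(2)}$ (Kac's notation). Each node $i$ of its Dynkin diagram carries a gauge algebra $\mathfrak g_i\in\{\mathfrak{su}(k_i),\mathfrak{so}(k_i),\mathfrak{usp}(k_i)\}$, with $k_i$ the dimension of the fundamental representation, and a (possibly trivial) flavour algebra whose fundamental representation has dimension $f^i\ge0$. Set $S^i=0,-1,+1$ and $d_i=2,1,1$ for $\mathfrak g_i=\mathfrak{su},\mathfrak{so},\mathfrak{usp}$ respectively. If $\mathfrak b$ is simply laced, either all nodes are $\mathfrak{su}$, or all are $\mathfrak{so}/\mathfrak{usp}$ with adjacent nodes of opposite type. If $\mathfrak b$ is not simply laced, nodes for long roots have $d_i=1$ (adjacent ones of opposite type) and nodes for short roots have $d_i=2$. Edges are bifundamental hypermultiplets: half-hypermultiplets for $\mathfrak{so}\oplus\mathfrak{usp}$, full hypermultiplets otherwise; similarly for gauge-flavour matter, $f^i$ counting full hypermultiplets for $\mathfrak{su}$ nodes and half-hypermultiplets for $\mathfrak{so},\mathfrak{usp}$ nodes. $C$ is the Cartan matrix of $\mathfrak b$ in the convention where $DC$ is symmetric, $D=\mathrm{diag}(d_i)$. Vanishing of all $\beta$-functions is the condition $C^{ij}k_j=f^i-4S^i$. The large-$N$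 limit takes $k_i\propto N\gg1$ for all $i$. **(Anti-)symmetric representations and doubling.** The remaining large-$N$ quivers are $\mathcal N=4$ super-Yang--Mills, for which $\lambda_{\max}=2$; $\mathfrak{usp}(k)$ with two half-hypermultiplets in the antisymmetric representation and eight fundamental half-hypermultiplets, for which $\lambda_{\max}=2$; and quivers with full hypermultiplets in the two-index symmetric $S^2$ or antisymmetric $\Lambda^2$ representation of an $\mathfrak{su}$ node at an end of the diagram (the end without trivalent or non-simply-laced structure). For the latter, $\lambda_{\max}$ is the largest eigenvalue of $2\cdot\mathbf 1-C$ for the doubled algebra, given by: $A_r$ with one $S^2$ or $\Lambda^2$ $\to A_{2r}$ (finite); $A_r$ with two of $S^2$ or $\Lambda^2$ $\to A_{2r-1}^{(1)}$; $D_r$ with one $\to D_{2r-1}^{(1)}$; $B_r$ or $C_r$ with one $\to A_{2r-1}^{(1)}$. A quiver whose doubled algebra is finite (resp. affine) counts as finite (resp. affine). **Rates.** $\mathfrak g_{\rm tot}=\bigoplus_i\mathfrak g_i$; $n_{\rm V}=\dim\mathfrak g_{\rm tot}$ is the number of vector multiplets and $n_{\rm H}$ the number of full hypermultiplets (counted with the dimension of their representation, a half-hypermultiplet counting $\frac12$). The central charge is $c=\frac1{24}(4n_{\rm V}+2n_{\rm H})$. The rates are $\kappa_i=\sqrt{2c/\dim\mathfrak g_i}$ and $\kappa_{\min}=\sqrt{2c/n_{\rm V}}=\sqrt{\tfrac16(2+n_{\rm H}/n_{\rm V})}$, the latter being the rate in the overall-free limit. In flat coordinates $\hat g_i$ on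 the conformal manifold at weak coupling, the gauge coupling of node $i$ behaves as $g_i\sim e^{-\kappa_i\hat g_i}$. "Orientifolds" of $\mathcal N=4$ super-Yang--Mills include its orbifold projections; all affine quivers arise in this way.
   Formalization: Saturation of 1/√2 at all values of N is stated only for N=4 SYM; for its orientifolds (affine quivers, usp with antisymmetrics) it is stated in the large-N limit, since at finite N it fails, e.g. su(k)×su(k) on A_1^(1) has n_H=2k², n_V=2k²−2. *)

theory Defs
  imports Complex_Main "Jordan_Normal_Form.Spectral_Radius"
begin

section \<open>Dynkin diagrams of finite and affine type\<close>

text \<open>\<open>AffA r\<close>, \dots, \<open>AffF4\<close> are the untwisted affine types $A_r^{(1)}$, \dots, $F_4^{(1)}$.
  The twisted types are \<open>TwD r\<close> for $D_{r+1}^{(2)}$, \<open>TwA r\<close> for $A_{2r-1}^{(2)}$ and \<open>TwE6\<close> for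
  $E_6^{(2)}$, so that every affine diagram with parameter \<open>r\<close> has \<open>r + 1\<close> nodes.\<close>

datatype dynkin =
    A nat | B nat | C nat | D nat | E nat | F4
  | AffA nat | AffB nat | AffC nat | AffD nat | AffE nat | AffF4
  | TwD nat | TwA nat | TwE6

text \<open>Kac's ranges, except that $B_2 = C_2$ is allowed under both names.\<close>

fun dynkin_ok :: "dynkin \<Rightarrow> bool" where
  "dynkin_ok (A r) = (r \<ge> 1)"
| "dynkin_ok (B r) = (r \<ge> 2)"
| "dynkin_ok (C r) = (r \<ge> 2)"
| "dynkin_ok (D r) = (r \<ge> 4)"
| "dynkin_ok (E r) = (r \<in> {6, 7, 8})"
| "dynkin_ok F4 = True"
| "dynkin_ok (AffA r) = (r \<ge> 1)"
| "dynkin_ok (AffB r) = (r \<ge> 3)"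
| "dynkin_ok (AffC r) = (r \<ge> 2)"
| "dynkin_ok (AffD r) = (r \<ge> 4)"
| "dynkin_ok (AffE r) = (r \<in> {6, 7, 8})"
| "dynkin_ok AffF4 = True"
| "dynkin_ok (TwD r) = (r \<ge> 2)"
| "dynkin_ok (TwA r) = (r \<ge> 3)"
| "dynkin_ok TwE6 = True"

fun affine_type :: "dynkin \<Rightarrow> bool" where
  "affine_type (A r) = False"
| "affine_type (B r) = False"
| "affine_type (C r) = False"
| "affine_type (D r) = False"
| "affine_type (E r) = False"
| "affine_type F4 = False"
| "affine_type _ = True"

fun num_nodes :: "dynkin \<Rightarrow> nat" where
  "num_nodes (A r) = r"
| "num_nodes (B r) = r"
| "num_nodes (C r) = r"
| "num_nodes (D r) = r"
| "num_nodes (E r) = r"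
| "num_nodes F4 = 4"
| "num_nodes (AffA r) = r + 1"
| "num_nodes (AffB r) = r + 1"
| "num_nodes (AffC r) = r + 1"
| "num_nodes (AffD r) = r + 1"
| "num_nodes (AffE r) = r + 1"
| "num_nodes AffF4 = 5"
| "num_nodes (TwD r) = r + 1"
| "num_nodes (TwA r) = r + 1"
| "num_nodes TwE6 = 5"

definition chain :: "nat \<Rightarrow> nat \<Rightarrow> (nat \<times> nat) list" where
  "chain m n = map (\<lambda>i. (i, Suc i)) [m..<n]"

text \<open>The edges of the diagram on the nodes \<open>0, \<dots>, num_nodes b - 1\<close>, each listed once, in one
  orientation.  A bond between roots of different length is one edge; the two bonds of
  $A_1^{(1)}$ are the two edges \<open>(0, 1)\<close> and \<open>(1, 0)\<close>.\<close>

fun edges :: "dynkin \<Rightarrow> (nat \<times> nat) list" where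
  "edges (A r) = chain 0 (r - 1)"
| "edges (B r) = chain 0 (r - 1)"
| "edges (C r) = chain 0 (r - 1)"
| "edges (D r) = chain 0 (r - 2) @ [(r - 3, r - 1)]"
| "edges (E r) = chain 0 (r - 2) @ [(2, r - 1)]"
| "edges F4 = chain 0 3"
| "edges (AffA r) = chain 0 r @ [(r, 0)]"
| "edges (AffB r) = chain 1 r @ [(0, 2)]"
| "edges (AffC r) = chain 0 r"
| "edges (AffD r) = chain 1 (r - 1) @ [(0, 2), (r - 2, r)]"
| "edges (AffE r) =
     chain 0 (r - 2) @ [(2, r - 1), (if r = 6 then 5 else if r = 7 then 0 else 6, r)]"
| "edges AffF4 = chain 0 4"
| "edges (TwD r) = chain 0 r"
| "edges (TwA r) = chain 1 r @ [(0, 2)]"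
| "edges TwE6 = chain 0 4"

text \<open>Empty exactly for the simply laced diagrams.\<close>

fun short_nodes :: "dynkin \<Rightarrow> nat set" where
  "short_nodes (B r) = {r - 1}"
| "short_nodes (C r) = {..<r - 1}"
| "short_nodes F4 = {2, 3}"
| "short_nodes (AffB r) = {r}"
| "short_nodes (AffC r) = {1..<r}"
| "short_nodes AffF4 = {3, 4}"
| "short_nodes (TwD r) = {0, r}"
| "short_nodes (TwA r) = {..<r}"
| "short_nodes TwE6 = {0, 1, 2}"
| "short_nodes _ = {}"

definition simply_laced :: "dynkin \<Rightarrow> bool" where
  "simply_laced b \<longleftrightarrow> short_nodes b = {}"

definition num_edges :: "dynkin \<Rightarrow> nat \<Rightarrow> nat \<Rightarrow> nat" where
  "num_edges b i j = count_list (edges b) (i, j) + count_list (edges b) (j, i)"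

definition adjacent :: "dynkin \<Rightarrow> nat \<Rightarrow> nat \<Rightarrow> bool" where
  "adjacent b i j \<longleftrightarrow> num_edges b i j > 0"

text \<open>The convention is $C_{ij} = 2(\alpha_i,\alpha_j)/(\alpha_j,\alpha_j)$, the transpose of Kac's:
  $DC$ is symmetric for $d_i = 1$ at long and $d_i = 2$ at short nodes.\<close>

definition cartan :: "dynkin \<Rightarrow> int mat" where
  "cartan b = mat (num_nodes b) (num_nodes b) (\<lambda>(i, j).
     if i = j then 2
     else - int (num_edges b i j) * (if i \<notin> short_nodes b \<and> j \<in> short_nodes b then 2 else 1))"

definition adjacency :: "dynkin \<Rightarrow> real mat" where
  "adjacency b = map_mat real_of_int (2 \<cdot>\<^sub>m 1\<^sub>m (num_nodes b) - cartan b)"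

text \<open>The adjacency matrix is similar to a real symmetric one, because $DC$ is symmetric with \<open>D\<close>
  diagonal and positive.  All its eigenvalues are therefore in the real spectrum.\<close>

definition largest_eigenvalue :: "dynkin \<Rightarrow> real" where
  "largest_eigenvalue b = Max (spectrum (adjacency b))"

text \<open>Column \<open>q\<close> holds $s_i(\alpha_q) = \alpha_q - 2\,(\alpha_q,\alpha_i)/(\alpha_i,\alpha_i)\,\alpha_i$
  in the basis of simple roots.\<close>

definition simple_reflection :: "dynkin \<Rightarrow> nat \<Rightarrow> int mat" where
  "simple_reflection b i = mat (num_nodes b) (num_nodes b) (\<lambda>(p, q).
     (if p = q then 1 else 0) - (if p = i then cartan b $$ (q, i) else 0))"

definition coxeter_element :: "dynkin \<Rightarrow> int mat" where
  "coxeter_element b =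
     foldr (\<lambda>i M. simple_reflection b i * M) [0..<num_nodes b] (1\<^sub>m (num_nodes b))"

text \<open>The order of a Coxeter element; it does not depend on the ordering of the simple reflections.
  Only used for diagrams of finite type.\<close>

definition coxeter_number :: "dynkin \<Rightarrow> nat" where
  "coxeter_number b = (LEAST h. h > 0 \<and> coxeter_element b ^\<^sub>m h = 1\<^sub>m (num_nodes b))"


section \<open>Gauge algebras and matter\<close>

datatype gauge = SU | SO | USP

fun gauge_ok :: "gauge \<Rightarrow> nat \<Rightarrow> bool" where
  "gauge_ok SU k = (k \<ge> 2)"
| "gauge_ok SO k = (k \<ge> 3)"
| "gauge_ok USP k = (k \<ge> 2 \<and> even k)"

fun gauge_dim :: "gauge \<Rightarrow> nat \<Rightarrow> real" where
  "gauge_dim SU k = (real k)\<^sup>2 - 1"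
| "gauge_dim SO k = real k * (real k - 1) / 2"
| "gauge_dim USP k = real k * (real k + 1) / 2"

fun gauge_S :: "gauge \<Rightarrow> int" where
  "gauge_S SU = 0"
| "gauge_S SO = -1"
| "gauge_S USP = 1"

fun gauge_d :: "gauge \<Rightarrow> nat" where
  "gauge_d SU = 2"
| "gauge_d SO = 1"
| "gauge_d USP = 1"

definition gauge_assignment :: "dynkin \<Rightarrow> (nat \<Rightarrow> gauge) \<Rightarrow> bool" where
  "gauge_assignment b g \<longleftrightarrow>
     (if simply_laced b then
        (\<forall>i<num_nodes b. g i = SU) \<or>
        ((\<forall>i<num_nodes b. g i \<in> {SO, USP}) \<and>
         (\<forall>i<num_nodes b. \<forall>j<num_nodes b. adjacent b i j \<longrightarrow> g i \<noteq> g j))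
      else
        (\<forall>i<num_nodes b. gauge_d (g i) = (if i \<in> short_nodes b then 2 else 1)) \<and>
        (\<forall>i<num_nodes b. \<forall>j<num_nodes b.
           i \<notin> short_nodes b \<and> j \<notin> short_nodes b \<and> adjacent b i j \<longrightarrow> g i \<noteq> g j))"

text \<open>Full hypermultiplets in a two-index representation of an \<open>su\<close> node.\<close>

datatype tensor = Sym2 | Alt2

fun tensor_dim :: "tensor \<Rightarrow> nat \<Rightarrow> real" where
  "tensor_dim Sym2 k = real k * (real k + 1) / 2"
| "tensor_dim Alt2 k = real k * (real k - 1) / 2"

text \<open>The Dynkin index of the representation in units of that of the fundamental: in the
  $\beta$-function the hypermultiplet counts as this many fundamental ones.\<close>

fun tensor_index :: "tensor \<Rightarrow> nat \<Rightarrow> int" where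
  "tensor_index Sym2 k = int k + 2"
| "tensor_index Alt2 k = int k - 2"

text \<open>\<open>Quiver b g t t'\<close> has gauge algebras of kind \<open>g i\<close> at the nodes \<open>i\<close> of \<open>b\<close>, and the optional
  two-index hypermultiplets \<open>t\<close> at the first node \<open>0\<close> and \<open>t'\<close> at the last node \<open>num_nodes b - 1\<close>.
  \<open>N4SYM g\<close> is $\mathcal N=4$ super-Yang--Mills; \<open>USpAlt\<close> is \<open>usp\<close> with two half-hypermultiplets in
  the antisymmetric and eight in the fundamental representation.  The latter two have the single
  node \<open>0\<close>.\<close>

datatype scft =
    Quiver dynkin "nat \<Rightarrow> gauge" "tensor option" "tensor option"
  | N4SYM gauge
  | USpAlt

definition num_tensors :: "tensor option \<Rightarrow> tensor option \<Rightarrow> nat" where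
  "num_tensors t t' = (if t = None then 0 else 1) + (if t' = None then 0 else 1)"

text \<open>Node \<open>0\<close> is the end of $B_r$, $C_r$, $D_r$ away from the double bond or the trivalent node.
  In type $B_r$ it is long, hence not \<open>su\<close>, so that no two-index hypermultiplet can occur there.\<close>

fun tensors_ok :: "dynkin \<Rightarrow> (nat \<Rightarrow> gauge) \<Rightarrow> tensor option \<Rightarrow> tensor option \<Rightarrow> bool" where
  "tensors_ok b g t t' \<longleftrightarrow>
     (t \<noteq> None \<longrightarrow> g 0 = SU) \<and> (t' \<noteq> None \<longrightarrow> g (num_nodes b - 1) = SU) \<and>
     (case b of
        A r \<Rightarrow> True
      | B r \<Rightarrow> t' = None
      | C r \<Rightarrow> t' = None
      | D r \<Rightarrow> t' = None
      | _ \<Rightarrow> t = None \<and> t' = None)"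

fun doubled :: "dynkin \<Rightarrow> nat \<Rightarrow> dynkin" where
  "doubled (A r) n = (if n = 0 then A r else if n = 1 then A (2 * r) else AffA (2 * r - 1))"
| "doubled (B r) n = (if n = 0 then B r else AffA (2 * r - 1))"
| "doubled (C r) n = (if n = 0 then C r else AffA (2 * r - 1))"
| "doubled (D r) n = (if n = 0 then D r else AffD (2 * r - 1))"
| "doubled b n = b"

fun scft_ok :: "scft \<Rightarrow> bool" where
  "scft_ok (Quiver b g t t') \<longleftrightarrow> dynkin_ok b \<and> gauge_assignment b g \<and> tensors_ok b g t t'"
| "scft_ok (N4SYM h) \<longleftrightarrow> True"
| "scft_ok USpAlt \<longleftrightarrow> True"

fun nodes :: "scft \<Rightarrow> nat" where
  "nodes (Quiver b g t t') = num_nodes b"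
| "nodes (N4SYM h) = 1"
| "nodes USpAlt = 1"

fun gauge_at :: "scft \<Rightarrow> nat \<Rightarrow> gauge" where
  "gauge_at (Quiver b g t t') i = g i"
| "gauge_at (N4SYM h) i = h"
| "gauge_at USpAlt i = USP"

definition tensors_at ::
  "dynkin \<Rightarrow> tensor option \<Rightarrow> tensor option \<Rightarrow> nat \<Rightarrow> tensor list" where
  "tensors_at b t t' i =
     (if i = 0 then (case t of None \<Rightarrow> [] | Some x \<Rightarrow> [x]) else []) @
     (if i = num_nodes b - 1 then (case t' of None \<Rightarrow> [] | Some x \<Rightarrow> [x]) else [])"

text \<open>In the following, \<open>k i\<close> is the dimension of the fundamental representation of the gauge
  algebra at node \<open>i\<close>, and \<open>f i\<close> that of its flavour algebra.  The second conjunct of \<open>conformal\<close>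
  for quivers is the vanishing of the $\beta$-functions.\<close>

fun conformal :: "scft \<Rightarrow> (nat \<Rightarrow> nat) \<Rightarrow> (nat \<Rightarrow> nat) \<Rightarrow> bool" where
  "conformal (Quiver b g t t') k f \<longleftrightarrow>
     (\<forall>i<num_nodes b. gauge_ok (g i) (k i)) \<and>
     (\<forall>i<num_nodes b.
        (\<Sum>j<num_nodes b. cartan b $$ (i, j) * int (k j))
          - (\<Sum>x\<leftarrow>tensors_at b t t' i. tensor_index x (k i))
        = int (f i) - 4 * gauge_S (g i))"
| "conformal (N4SYM h) k f \<longleftrightarrow> gauge_ok h (k 0) \<and> f 0 = 0"
| "conformal USpAlt k f \<longleftrightarrow> gauge_ok USP (k 0) \<and> f 0 = 8"

definition n_V :: "scft \<Rightarrow> (nat \<Rightarrow> nat) \<Rightarrow> real" where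
  "n_V T k = (\<Sum>i<nodes T. gauge_dim (gauge_at T i) (k i))"

text \<open>Full hypermultiplets count \<open>1\<close>, half-hypermultiplets \<open>1/2\<close>: the latter are the
  \<open>so\<close>--\<open>usp\<close> bifundamentals and the fundamentals of \<open>so\<close> and \<open>usp\<close> nodes.
  In \<open>USpAlt\<close> the antisymmetric representation is the full $\Lambda^2$, including its singlet.\<close>

definition bifund_weight :: "gauge \<Rightarrow> gauge \<Rightarrow> real" where
  "bifund_weight g h = (if g \<noteq> SU \<and> h \<noteq> SU then 1 / 2 else 1)"

definition fund_weight :: "gauge \<Rightarrow> real" where
  "fund_weight g = (if g = SU then 1 else 1 / 2)"

fun n_H :: "scft \<Rightarrow> (nat \<Rightarrow> nat) \<Rightarrow> (nat \<Rightarrow> nat) \<Rightarrow> real" where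
  "n_H (Quiver b g t t') k f =
     (\<Sum>(i, j)\<leftarrow>edges b. bifund_weight (g i) (g j) * real (k i) * real (k j))
     + (\<Sum>i<num_nodes b. fund_weight (g i) * real (f i) * real (k i))
     + (\<Sum>i<num_nodes b. \<Sum>x\<leftarrow>tensors_at b t t' i. tensor_dim x (k i))"
| "n_H (N4SYM h) k f = gauge_dim h (k 0)"
| "n_H USpAlt k f =
     2 * (1 / 2) * tensor_dim Alt2 (k 0) + fund_weight USP * real (f 0) * real (k 0)"

definition central_charge :: "scft \<Rightarrow> (nat \<Rightarrow> nat) \<Rightarrow> (nat \<Rightarrow> nat) \<Rightarrow> real" where
  "central_charge T k f = (4 * n_V T k + 2 * n_H T k f) / 24"

definition rate :: "scft \<Rightarrow> (nat \<Rightarrow> nat) \<Rightarrow> (nat \<Rightarrow> nat) \<Rightarrow> nat \<Rightarrow> real" where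
  "rate T k f i = sqrt (2 * central_charge T k f / gauge_dim (gauge_at T i) (k i))"

definition rate_min :: "scft \<Rightarrow> (nat \<Rightarrow> nat) \<Rightarrow> (nat \<Rightarrow> nat) \<Rightarrow> real" where
  "rate_min T k f = sqrt (2 * central_charge T k f / n_V T k)"

text \<open>The two single-node theories count as affine: like the quivers with affine (doubled) algebra
  they are orientifolds of $\mathcal N=4$ super-Yang--Mills.\<close>

fun affine_scft :: "scft \<Rightarrow> bool" where
  "affine_scft (Quiver b g t t') = affine_type (doubled b (num_tensors t t'))"
| "affine_scft (N4SYM h) = True"
| "affine_scft USpAlt = True"

fun lambda_max :: "scft \<Rightarrow> real" where
  "lambda_max (Quiver b g t t') = largest_eigenvalue (doubled b (num_tensors t t'))"
| "lambda_max (N4SYM h) = 2"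
| "lambda_max USpAlt = 2"

text \<open>A family with fixed quiver and matter representations, indexed by \<open>m\<close>, in which
  $k_i \propto N \to \infty$ for all nodes.\<close>

definition large_N_family ::
  "scft \<Rightarrow> (nat \<Rightarrow> nat \<Rightarrow> nat) \<Rightarrow> (nat \<Rightarrow> nat \<Rightarrow> nat) \<Rightarrow> bool" where
  "large_N_family T k f \<longleftrightarrow>
     scft_ok T \<and> (\<forall>m. conformal T (k m) (f m)) \<and>
     (\<exists>N :: nat \<Rightarrow> real. filterlim N at_top sequentially \<and>
        (\<forall>i<nodes T. \<exists>x>0. (\<lambda>m. real (k m i) / N m) \<longlonglongrightarrow> x))"

end

theory Submission
  imports Defs
begin

text \<open>Let \<open>X\<close> be the limit of the ranks \<open>k / N\<close> and \<open>M = 2 - C\<close>, with the number of two-index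
  hypermultiplets of a node added to its diagonal entry.  The \<open>\<beta>\<close>-function conditions turn
  \<open>n_H / n_V\<close> into \<open>2 - Q / (4 V)\<close> with \<open>Q = X\<^sup>T D M X\<close> and \<open>V = X\<^sup>T D X / 2\<close>.  A positive
  eigenvector of \<open>M\<close>, folded from that of the doubled diagram, bounds \<open>Q\<close> by \<open>2 \<lambda> V\<close>; if
  \<open>\<lambda> = 2\<close>, pairing it with the flavour condition \<open>2 X - M X \<ge> 0\<close> forces \<open>M X = 2 X\<close>.

  For finite type the eigenvectors are explicit in \<open>\<theta> = \<pi> / h\<close>, and \<open>h\<close> has to be identified
  with the order of the Coxeter element.  Orbits of the latter are the solutions of the mesh
  relation on the repetition quiver of the diagram.  On a chain the differences of neighbouring
  values are shifted (with a sign in types B, C, D), and types E and F are computed, which gives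
  the period \<open>h\<close>; the eigenvector for \<open>2 cos \<theta>\<close>, multiplied by a phase that turns by \<open>2 \<theta>\<close> in each step,
  has no smaller period.\<close>

section \<open>Neighbour sums\<close>

text \<open>A single explicit positive eigenvector does two jobs: it identifies the largest
  eigenvalue of the spectrum and it bounds the quadratic form of the ranks. The symmetrizer remains
  a parameter because two of them occur: the root-length weights of the diagram, and the weights d_i
  of the gauge assignment, which are all 2 on a simply laced su quiver.

  The constants of the bound come from \<kappa>_min^2 = (2 + n_H / n_V) / 6, whose limit is 2/3 - Q
  / (24 V); inserting Q \<le> 2 \<lambda> V gives 2/3 - \<lambda>/12 = 1/2 + (2 - \<lambda>)/12.

  The obstacle is the Coxeter number. It is defined as the least order of a product of as many
  reflections as there are nodes, so for the infinite families no evaluation of matrices at fixed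
  size can find it. Hence the order is restated as a common period of sequences: that h is a period
  is shown for every orbit, that nothing smaller is a period follows from one trigonometric
  orbit.\<close>

definition bond :: "dynkin \<Rightarrow> nat \<Rightarrow> nat \<Rightarrow> real" where
  "bond b i j = (if i \<notin> short_nodes b \<and> j \<in> short_nodes b then 2 else 1)"

text \<open>Running over the edge list lets rewriting evaluate rows and columns of the adjacency
  matrix at symbolic rank, and counts the two parallel edges of \<open>AffA 1\<close> twice, as it
  should.\<close>

definition nbr_sum :: "(nat \<times> nat) list \<Rightarrow> nat \<Rightarrow> (nat \<Rightarrow> real) \<Rightarrow> real" where
  "nbr_sum es i G = (\<Sum>(u, v)\<leftarrow>es. (if u = i then G v else 0) + (if v = i then G u else 0))"

lemma nbr_sum_Nil [simp]: "nbr_sum [] i G = 0"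
  by (simp add: nbr_sum_def)

lemma nbr_sum_Cons [simp]:
  "nbr_sum ((u, v) # es) i G
     = (if u = i then G v else 0) + (if v = i then G u else 0) + nbr_sum es i G"
  by (simp add: nbr_sum_def)

lemma nbr_sum_append [simp]: "nbr_sum (es @ es') i G = nbr_sum es i G + nbr_sum es' i G"
  by (simp add: nbr_sum_def)

lemma chain_Suc: "m \<le> n \<Longrightarrow> chain m (Suc n) = chain m n @ [(n, Suc n)]"
  by (simp add: chain_def)

lemma chain_empty [simp]: "n \<le> m \<Longrightarrow> chain m n = []"
  by (simp add: chain_def)

lemma set_chain: "set (chain m n) = {(i, Suc i) |i. m \<le> i \<and> i < n}"
  by (auto simp: chain_def)

lemma nbr_sum_chain [simp]:
  "nbr_sum (chain m n) i G
     = (if m \<le> i \<and> i < n then G (Suc i) else 0) + (if m < i \<and> i \<le> n then G (i - 1) else 0)"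
proof (induction n)
  case (Suc n)
  show ?case
  proof (cases "m \<le> n")
    case True
    then show ?thesis using Suc by (auto simp: chain_Suc)
  next
    case False
    then show ?thesis by auto
  qed
qed auto

lemma nbr_sum_cong:
  assumes "\<And>u v. (u, v) \<in> set es \<Longrightarrow> (u = i \<longrightarrow> G v = H v) \<and> (v = i \<longrightarrow> G u = H u)"
  shows "nbr_sum es i G = nbr_sum es i H"
  using assms unfolding nbr_sum_def by (intro arg_cong[of _ _ sum_list] map_cong) auto

lemma nbr_sum_mult: "nbr_sum es i (\<lambda>j. c * G j) = c * nbr_sum es i G"
  by (induction es) (auto simp: algebra_simps)

lemma edges_range:
  assumes "dynkin_ok b" "(u, v) \<in> set (edges b)"
  shows "u < num_nodes b" "v < num_nodes b" "u \<noteq> v"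
  using assms by (cases b; auto simp: set_chain split: if_splits)+

lemma sum_count_list:
  fixes G :: "nat \<Rightarrow> real"
  assumes "\<And>u v. (u, v) \<in> set es \<Longrightarrow> u < n \<and> v < n"
  shows "(\<Sum>j<n. real (count_list es (i, j) + count_list es (j, i)) * G j) = nbr_sum es i G"
  using assms
proof (induction es)
  case (Cons e es)
  obtain u v where e: "e = (u, v)" by (cases e)
  have uv: "u < n" "v < n" using Cons.prems e by auto
  have eq: "real (count_list (e # es) (i, j) + count_list (e # es) (j, i)) * G j
      = (if j = v then (if u = i then G v else 0) else 0)
      + (if j = u then (if v = i then G u else 0) else 0)
      + real (count_list es (i, j) + count_list es (j, i)) * G j" for j
    by (auto simp: e algebra_simps)
  show ?case unfolding eq sum.distrib using Cons uv by (auto simp: e)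
qed simp

lemma cartan_dim [simp]: "dim_row (cartan b) = num_nodes b" "dim_col (cartan b) = num_nodes b"
  by (simp_all add: cartan_def)

abbreviation adj :: "dynkin \<Rightarrow> nat \<Rightarrow> nat \<Rightarrow> real" where
  "adj b i j \<equiv> adjacency b $$ (i, j)"

lemma adj_eq:
  assumes "i < num_nodes b" "j < num_nodes b"
  shows "adj b i j = (if i = j then 0 else real (num_edges b i j) * bond b i j)"
  using assms by (auto simp: adjacency_def cartan_def bond_def)

lemma adj_eq':
  assumes "dynkin_ok b" "i < num_nodes b" "j < num_nodes b"
  shows "adj b i j = real (num_edges b i j) * bond b i j"
proof -
  have "num_edges b i i = 0"
    using edges_range(3)[OF assms(1), of i i] by (auto simp: num_edges_def count_list_0_iff)
  then show ?thesis using assms by (auto simp: adj_eq)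
qed

lemma cartan_adj:
  assumes "i < num_nodes b" "j < num_nodes b"
  shows "real_of_int (cartan b $$ (i, j)) = (if i = j then 2 else 0) - adj b i j"
  using assms by (auto simp: adjacency_def)

lemma adj_row_sum:
  assumes "dynkin_ok b" "i < num_nodes b"
  shows "(\<Sum>j<num_nodes b. adj b i j * G j) = nbr_sum (edges b) i (\<lambda>j. bond b i j * G j)"
proof -
  have "(\<Sum>j<num_nodes b. adj b i j * G j)
      = (\<Sum>j<num_nodes b. real (num_edges b i j) * (bond b i j * G j))"
    by (intro sum.cong) (use assms in \<open>auto simp: adj_eq'\<close>)
  also have "\<dots> = nbr_sum (edges b) i (\<lambda>j. bond b i j * G j)"
    unfolding num_edges_def using edges_range[OF assms(1)] by (intro sum_count_list) auto
  finally show ?thesis .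
qed

text \<open>Columns are what the Coxeter element sees: row \<open>i\<close> of
  \<open>simple_reflection b i\<close> contains the entries
  \<open>cartan b $$ (q, i)\<close>.\<close>

lemma adj_column_sum:
  assumes "dynkin_ok b" "i < num_nodes b"
  shows "(\<Sum>j<num_nodes b. adj b j i * G j) = nbr_sum (edges b) i (\<lambda>j. bond b j i * G j)"
proof -
  have "(\<Sum>j<num_nodes b. adj b j i * G j)
      = (\<Sum>j<num_nodes b. real (num_edges b i j) * (bond b j i * G j))"
    by (intro sum.cong) (use assms in \<open>auto simp: adj_eq' num_edges_def\<close>)
  also have "\<dots> = nbr_sum (edges b) i (\<lambda>j. bond b j i * G j)"
    unfolding num_edges_def using edges_range[OF assms(1)] by (intro sum_count_list) auto
  finally show ?thesis .
qed

lemma adj_nonneg: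
  assumes "i < num_nodes b" "j < num_nodes b"
  shows "0 \<le> adj b i j"
  using assms by (auto simp: adj_eq bond_def)

text \<open>The symmetrizer D read off from the diagram alone, so that spectral statements about a
  diagram do not refer to a gauge assignment.\<close>

definition short_weight :: "dynkin \<Rightarrow> nat \<Rightarrow> real" where
  "short_weight b i = (if i \<in> short_nodes b then 2 else 1)"

lemma short_weight_bond: "short_weight b i * bond b i j = short_weight b j * bond b j i"
  by (auto simp: short_weight_def bond_def)

lemma short_weight_pos: "0 < short_weight b i"
  by (auto simp: short_weight_def)

lemma short_weight_adj:
  assumes "i < num_nodes b" "j < num_nodes b"
  shows "short_weight b i * adj b i j = short_weight b j * adj b j i"
  using assms short_weight_bond[of b i j] by (auto simp: adj_eq num_edges_def add.commute)

section \<open>Positive eigenvectors of symmetrizable nonnegative matrices\<close>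

locale positive_eigenvector =
  fixes n :: nat and M :: "nat \<Rightarrow> nat \<Rightarrow> real" and d p :: "nat \<Rightarrow> real" and \<rho> :: real
  assumes nonneg: "\<lbrakk>i < n; j < n\<rbrakk> \<Longrightarrow> 0 \<le> M i j"
    and symm: "\<lbrakk>i < n; j < n\<rbrakk> \<Longrightarrow> d i * M i j = d j * M j i"
    and d_pos: "i < n \<Longrightarrow> 0 < d i"
    and p_pos: "i < n \<Longrightarrow> 0 < p i"
    and eigen: "i < n \<Longrightarrow> (\<Sum>j<n. M i j * p j) = \<rho> * p i"
begin

text \<open>\<open>M\<close> is self-adjoint for the inner product weighted by \<open>d\<close>, so
  it can be moved onto its eigenvector \<open>p\<close>.\<close>

lemma pairing: "(\<Sum>i<n. d i * p i * (\<Sum>j<n. M i j * x j)) = \<rho> * (\<Sum>i<n. d i * p i * x i)"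
proof -
  have "(\<Sum>i<n. d i * p i * (\<Sum>j<n. M i j * x j)) = (\<Sum>i<n. \<Sum>j<n. (d i * M i j) * p i * x j)"
    by (simp add: sum_distrib_left algebra_simps)
  also have "\<dots> = (\<Sum>j<n. \<Sum>i<n. (d i * M i j) * p i * x j)"
    by (rule sum.swap)
  also have "\<dots> = (\<Sum>j<n. \<Sum>i<n. (d j * M j i) * p i * x j)"
    by (intro sum.cong refl) (simp add: symm)
  also have "\<dots> = (\<Sum>j<n. d j * x j * (\<Sum>i<n. M j i * p i))"
    by (simp add: sum_distrib_left algebra_simps)
  also have "\<dots> = (\<Sum>j<n. d j * x j * (\<rho> * p j))"
    by (simp add: eigen)
  also have "\<dots> = \<rho> * (\<Sum>i<n. d i * p i * x i)"
    by (simp add: sum_distrib_left mult_ac)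
  finally show ?thesis .
qed

lemma left_eigen: 
  assumes "i < n"
  shows "(\<Sum>j<n. M j i * (d j * p j)) = \<rho> * (d i * p i)"
proof -
  have "(\<Sum>j<n. M j i * (d j * p j)) = (\<Sum>j<n. (d j * M j i) * p j)"
    by (simp add: algebra_simps)
  also have "\<dots> = (\<Sum>j<n. (d i * M i j) * p j)"
    by (intro sum.cong refl) (use assms symm in auto)
  also have "\<dots> = d i * (\<Sum>j<n. M i j * p j)"
    by (simp add: sum_distrib_left algebra_simps)
  also have "\<dots> = d i * (\<rho> * p i)"
    using assms by (simp add: eigen)
  finally show ?thesis by (simp add: mult_ac)
qed

text \<open>The triangle inequality gives \<mu> |v| \<le> M |v| entrywise. Pairing with the positive
  vector \<open>p\<close> turns the right-hand side into \<rho> times the same positive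
  number.\<close>

lemma eigenvalue_le:
  assumes v: "\<And>i. i < n \<Longrightarrow> (\<Sum>j<n. M i j * v j) = \<mu> * v i"
    and i0: "i0 < n" "v i0 \<noteq> 0"
  shows "\<mu> \<le> \<rho>"
proof -
  have "\<mu> * \<bar>v i\<bar> \<le> (\<Sum>j<n. M i j * \<bar>v j\<bar>)" if "i < n" for i
  proof -
    have "\<mu> * \<bar>v i\<bar> \<le> \<bar>\<mu> * v i\<bar>"
      by (simp add: abs_mult mult_right_mono)
    also have "\<dots> \<le> (\<Sum>j<n. \<bar>M i j * v j\<bar>)"
      using v[OF that] sum_abs[of "\<lambda>j. M i j * v j" "{..<n}"] by simp
    also have "\<dots> = (\<Sum>j<n. M i j * \<bar>v j\<bar>)"
      using nonneg that by (intro sum.cong) (auto simp: abs_mult)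
    finally show ?thesis .
  qed
  then have "(\<Sum>i<n. d i * p i * (\<mu> * \<bar>v i\<bar>)) \<le> (\<Sum>i<n. d i * p i * (\<Sum>j<n. M i j * \<bar>v j\<bar>))"
    using d_pos p_pos by (intro sum_mono mult_left_mono) (auto simp: less_imp_le)
  then have "\<mu> * (\<Sum>i<n. d i * p i * \<bar>v i\<bar>) \<le> \<rho> * (\<Sum>i<n. d i * p i * \<bar>v i\<bar>)"
    unfolding pairing by (simp add: sum_distrib_left algebra_simps)
  moreover have "0 < (\<Sum>i<n. d i * p i * \<bar>v i\<bar>)"
    using i0 d_pos p_pos by (intro sum_pos2[of _ i0]) (auto simp: less_imp_le)
  ultimately show ?thesis by simp
qed

text \<open>AM-GM in the form
  $2 x_i x_j \le x_i^2\, p_j / p_i + x_j^2\, p_i / p_j$ makes the eigenvector equation applicable.\<close>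

lemma rayleigh: "(\<Sum>i<n. d i * x i * (\<Sum>j<n. M i j * x j)) \<le> \<rho> * (\<Sum>i<n. d i * (x i)\<^sup>2)"
proof -
  have amgm: "2 * (x i * x j) \<le> (x i)\<^sup>2 * (p j / p i) + (x j)\<^sup>2 * (p i / p j)"
    if "i < n" "j < n" for i j
  proof -
    have p: "0 < p i" "0 < p j" using p_pos that by auto
    have "0 \<le> (x i * p j - x j * p i)\<^sup>2 / (p i * p j)"
      using p by (intro divide_nonneg_pos) auto
    also have "\<dots> = (x i)\<^sup>2 * (p j / p i) + (x j)\<^sup>2 * (p i / p j) - 2 * (x i * x j)"
      using p by (simp add: field_simps power2_eq_square)
    finally show ?thesis by simp
  qed
  have "2 * (\<Sum>i<n. d i * x i * (\<Sum>j<n. M i j * x j))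
      = (\<Sum>i<n. \<Sum>j<n. d i * M i j * (2 * (x i * x j)))"
    by (simp add: sum_distrib_left algebra_simps)
  also have "\<dots> \<le> (\<Sum>i<n. \<Sum>j<n. d i * M i j * ((x i)\<^sup>2 * (p j / p i) + (x j)\<^sup>2 * (p i / p j)))"
    using amgm nonneg d_pos by (intro sum_mono mult_left_mono) (auto simp: less_imp_le)
  also have "\<dots> = (\<Sum>i<n. \<Sum>j<n. d i * M i j * ((x i)\<^sup>2 * (p j / p i)))
      + (\<Sum>i<n. \<Sum>j<n. d i * M i j * ((x j)\<^sup>2 * (p i / p j)))"
    by (simp add: distrib_left sum.distrib)
  also have "(\<Sum>i<n. \<Sum>j<n. d i * M i j * ((x j)\<^sup>2 * (p i / p j)))
      = (\<Sum>j<n. \<Sum>i<n. d i * M i j * ((x j)\<^sup>2 * (p i / p j)))"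
    by (rule sum.swap)
  also have "\<dots> = (\<Sum>i<n. \<Sum>j<n. d i * M i j * ((x i)\<^sup>2 * (p j / p i)))"
    by (intro sum.cong refl) (simp add: symm)
  also have "(\<Sum>i<n. \<Sum>j<n. d i * M i j * ((x i)\<^sup>2 * (p j / p i)))
      = (\<Sum>i<n. d i * (x i)\<^sup>2 / p i * (\<Sum>j<n. M i j * p j))"
    by (simp add: sum_distrib_left sum_divide_distrib mult_ac)
  also have "\<dots> = (\<Sum>i<n. \<rho> * (d i * (x i)\<^sup>2))"
  proof (intro sum.cong refl)
    fix i assume "i \<in> {..<n}"
    then show "d i * (x i)\<^sup>2 / p i * (\<Sum>j<n. M i j * p j) = \<rho> * (d i * (x i)\<^sup>2)"
      using p_pos[of i] by (simp add: eigen)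
  qed
  also have "\<dots> = \<rho> * (\<Sum>i<n. d i * (x i)\<^sup>2)"
    by (simp add: sum_distrib_left)
  finally show ?thesis by simp
qed

text \<open>The positive left null vector \<open>d p\<close> of \<open>2 - M\<close> is orthogonal to \<open>2 x - M x\<close>.\<close>

lemma superharmonic_eq:
  assumes "\<rho> = 2" and x: "\<And>i. i < n \<Longrightarrow> (\<Sum>j<n. M i j * x j) \<le> 2 * x i" and i: "i < n"
  shows "(\<Sum>j<n. M i j * x j) = 2 * x i"
proof -
  have "(\<Sum>i<n. d i * p i * (2 * x i - (\<Sum>j<n. M i j * x j))) = 0"
    using pairing[of x] assms(1) by (simp add: right_diff_distrib sum_subtractf sum_distrib_left algebra_simps)
  moreover have "0 \<le> d i * p i * (2 * x i - (\<Sum>j<n. M i j * x j))" if "i < n" for i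
    using d_pos[OF that] p_pos[OF that] x[OF that] by simp
  ultimately have "d i * p i * (2 * x i - (\<Sum>j<n. M i j * x j)) = 0"
    using i by (subst (asm) sum_nonneg_eq_0_iff) auto
  then show ?thesis using d_pos[OF i] p_pos[OF i] by simp
qed

end

lemma largest_eigenvalue_eqI:
  assumes ok: "dynkin_ok b"
    and ev: "positive_eigenvector (num_nodes b) (adj b) (short_weight b) p \<rho>"
  shows "largest_eigenvalue b = \<rho>"
proof -
  interpret positive_eigenvector "num_nodes b" "adj b" "short_weight b" p \<rho> by (rule ev)
  let ?n = "num_nodes b"
  have A: "adjacency b \<in> carrier_mat ?n ?n"
    by (intro carrier_matI) (simp_all add: adjacency_def)
  have n: "0 < ?n" using ok by (cases b) auto
  have mv: "(adjacency b *\<^sub>v v) $ i = (\<Sum>j<?n. adj b i j * v $ j)"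
    if "v \<in> carrier_vec ?n" "i < ?n" for v i
    using that A by (auto simp: scalar_prod_def lessThan_atLeast0)
  have "eigenvector (adjacency b) (vec ?n p) \<rho>"
    unfolding eigenvector_def
  proof (intro conjI)
    show "vec ?n p \<noteq> 0\<^sub>v (dim_row (adjacency b))"
    proof
      assume "vec ?n p = 0\<^sub>v (dim_row (adjacency b))"
      then have "vec ?n p $ 0 = 0\<^sub>v ?n $ 0" using A by auto
      then show False using n p_pos[OF n] by simp
    qed
    show "adjacency b *\<^sub>v vec ?n p = \<rho> \<cdot>\<^sub>v vec ?n p"
      using A mv[of "vec ?n p"] eigen by (intro eq_vecI) auto
  qed (use A in auto)
  then have "\<rho> \<in> spectrum (adjacency b)"
    by (auto simp: spectrum_def eigenvalue_def)
  moreover have "\<mu> \<le> \<rho>" if \<mu>: "\<mu> \<in> spectrum (adjacency b)" for \<mu>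
  proof -
    obtain v where v: "v \<in> carrier_vec ?n" "v \<noteq> 0\<^sub>v ?n" "adjacency b *\<^sub>v v = \<mu> \<cdot>\<^sub>v v"
      using \<mu> A by (auto simp: spectrum_def eigenvalue_def eigenvector_def)
    obtain i0 where "i0 < ?n" "v $ i0 \<noteq> 0"
      using v(1,2) by (metis carrier_vecD eq_vecI index_zero_vec)
    moreover have "(\<Sum>j<?n. adj b i j * v $ j) = \<mu> * v $ i" if "i < ?n" for i
      using mv[OF v(1) that] v that by auto
    ultimately show ?thesis using eigenvalue_le[of "\<lambda>i. v $ i" \<mu> i0] by auto
  qed
  ultimately show ?thesis
    unfolding largest_eigenvalue_def using card_finite_spectrum(1)[OF A] by (intro Max_eqI) auto
qed

section \<open>Eigenvectors of the Dynkin diagrams\<close>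

text \<open>Null vectors of the affine Cartan matrices. As \<open>cartan\<close> is the transpose of
  Kac's matrix, these are Kac's dual marks, in the node order of \<open>edges\<close>; the final
  clause serves \<open>AffA\<close> and \<open>AffC\<close>.\<close>

fun affine_marks :: "dynkin \<Rightarrow> nat \<Rightarrow> real" where
  "affine_marks (AffB r) i = (if i \<le> 1 \<or> i = r then 1 else 2)"
| "affine_marks (AffD r) i = (if i \<le> 1 \<or> r - 1 \<le> i then 1 else 2)"
| "affine_marks (AffE r) i =
     (if r = 6 then [1, 2, 3, 2, 1, 2, 1] else if r = 7 then [2, 3, 4, 3, 2, 1, 2, 1]
      else [2, 4, 6, 5, 4, 3, 2, 3, 1]) ! i"
| "affine_marks AffF4 i = [1, 2, 3, 2, 1] ! i"
| "affine_marks (TwD r) i = (if i = 0 \<or> i = r then 1 else 2)"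
| "affine_marks (TwA r) i = (if i \<le> 1 then 1 else 2)"
| "affine_marks TwE6 i = [1, 2, 3, 4, 2] ! i"
| "affine_marks _ i = 1"

lemma less_9_cases: "i < 9 \<Longrightarrow> i \<in> {0, 1, 2, 3, 4, 5, 6, 7, 8}" for i :: nat
  by auto

lemma affine_marks_pos:
  assumes "dynkin_ok b" "affine_type b" "i < num_nodes b"
  shows "0 < affine_marks b i"
  using assms less_9_cases[of i] by (cases b) auto

lemma affine_marks_eigen:
  assumes "dynkin_ok b" "affine_type b" "i < num_nodes b"
  shows "nbr_sum (edges b) i (\<lambda>j. bond b i j * affine_marks b j) = 2 * affine_marks b i"
proof (cases b)
  case (AffA r)
  then show ?thesis using assms by (auto simp: bond_def)
next
  case (AffB r)
  then show ?thesis using assms by (cases i; cases "i = r") (auto simp: bond_def)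
next
  case (AffC r)
  then show ?thesis using assms by (cases i) (simp_all add: bond_def)
next
  case (AffD r)
  then obtain s where r: "b = AffD (s + 4)"
    using assms le_Suc_ex[of 4 r] by (auto simp: add.commute)
  consider "i = 0" | "i = 1" | "i = s + 4" | "i = s + 3" | "i = s + 2" | "2 \<le> i" "i < s + 2"
    using assms r by force
  then show ?thesis
  proof cases
    case 5
    \<comment> \<open>For \<open>s = 0\<close> the two branch nodes coincide in one node with four
      end nodes around it.\<close>
    then show ?thesis by (cases s) (simp_all add: r bond_def)
  next
    case 6
    then obtain j where j: "i = Suc (Suc j)" "j < s"
      by (auto dest!: le_Suc_ex)
    then show ?thesis by (cases j) (simp_all add: r bond_def)
  qed (simp_all add: r bond_def)
next
  case (AffE r)
  consider "r = 6" | "r = 7" | "r = 8" using assms AffE by auto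
  then show ?thesis
  proof cases
    case 1
    then have "i \<in> {0, 1, 2, 3, 4, 5, 6}" using assms AffE by auto
    then show ?thesis by (elim insertE emptyE; simp add: AffE 1 bond_def)
  next
    case 2
    then have "i \<in> {0, 1, 2, 3, 4, 5, 6, 7}" using assms AffE by auto
    then show ?thesis by (elim insertE emptyE; simp add: AffE 2 bond_def)
  next
    case 3
    then have "i \<in> {0, 1, 2, 3, 4, 5, 6, 7, 8}" using assms AffE by auto
    then show ?thesis by (elim insertE emptyE; simp add: AffE 3 bond_def)
  qed
next
  case AffF4
  then have "i \<in> {0, 1, 2, 3, 4}" using assms by auto
  then show ?thesis by (elim insertE emptyE; simp add: AffF4 bond_def)
next
  case (TwD r)
  then show ?thesis using assms by (cases i) (simp_all add: bond_def)
next
  case (TwA r)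
  then show ?thesis using assms by (cases i; cases "i = r") (auto simp: bond_def)
next
  case TwE6
  then have "i \<in> {0, 1, 2, 3, 4}" using assms by auto
  then show ?thesis by (elim insertE emptyE; simp add: TwE6 bond_def)
qed (use assms in auto)

text \<open>The textbook table of Coxeter numbers, with \<open>F4\<close> in the final clause. That
  it gives the order of the Coxeter element is only shown in
  \<open>coxeter_number_eq\<close>.\<close>

fun cox :: "dynkin \<Rightarrow> nat" where
  "cox (A r) = r + 1"
| "cox (B r) = 2 * r"
| "cox (C r) = 2 * r"
| "cox (D r) = 2 * (r - 1)"
| "cox (E r) = (if r = 6 then 12 else if r = 7 then 18 else 30)"
| "cox _ = 12"

abbreviation theta :: "dynkin \<Rightarrow> real" where
  "theta b \<equiv> pi / real (cox b)"

text \<open>On a chain these are $\sin((i+1)\theta)$; the arms of type E are normalised to \<open>1\<close> at the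
  trivalent node.\<close>

fun finite_marks :: "dynkin \<Rightarrow> nat \<Rightarrow> real" where
  "finite_marks (B r) i = (if i = r - 1 then 1 / 2 else sin (real (i + 1) * theta (B r)))"
| "finite_marks (D r) i = (if r - 2 \<le> i then 1 / 2 else sin (real (i + 1) * theta (D r)))"
| "finite_marks (E r) i =
     (if i = r - 1 then sin (theta (E r)) / sin (2 * theta (E r))
      else if i \<le> 2 then sin (real (i + 1) * theta (E r)) / sin (3 * theta (E r))
      else sin (real (r - 1 - i) * theta (E r)) / sin (real (r - 3) * theta (E r)))"
| "finite_marks F4 i =
     (if i \<le> 1 then sin (real (i + 1) * theta F4)
      else sin (real (4 - i) * theta F4) * (sin (3 * theta F4) / (2 * sin (2 * theta F4))))"
| "finite_marks b i = sin (real (i + 1) * theta b)"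

lemma sin_mult_theta_pos: "0 < m \<Longrightarrow> m < h \<Longrightarrow> 0 < sin (real m * (pi / real h))"
  by (intro sin_gt_zero) (auto simp: field_simps)

lemma finite_marks_pos:
  assumes "dynkin_ok b" "\<not> affine_type b" "i < num_nodes b"
  shows "0 < finite_marks b i"
proof -
  have s: "0 < sin (2 * theta b)" "0 < sin (3 * theta b)" "0 < sin (theta b)"
    if "3 < cox b"
    using sin_mult_theta_pos[of 2 "cox b"] sin_mult_theta_pos[of 3 "cox b"]
      sin_mult_theta_pos[of 1 "cox b"] that by auto
  show ?thesis
  proof (cases b)
    case (A r)
    then show ?thesis using assms sin_mult_theta_pos[of "i + 1" "cox b"] by simp
  next
    case (B r)
    then show ?thesis using assms sin_mult_theta_pos[of "i + 1" "cox b"] by auto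
  next
    case (C r)
    then show ?thesis using assms sin_mult_theta_pos[of "i + 1" "cox b"] by auto
  next
    case (D r)
    then show ?thesis using assms sin_mult_theta_pos[of "i + 1" "cox b"] by auto
  next
    case (E r)
    then have "0 < sin (real (i + 1) * theta (E r))" "0 < sin (real (r - 3) * theta (E r))"
      "i < r - 1 \<Longrightarrow> 0 < sin (real (r - 1 - i) * theta (E r))"
      using assms by (intro sin_mult_theta_pos; auto)+
    then show ?thesis using s E assms by auto
  next
    case F4
    then have "0 < sin (real (i + 1) * theta F4)" "0 < sin (real (4 - i) * theta F4)"
      using assms by (intro sin_mult_theta_pos; auto)+
    then show ?thesis using s F4 assms by auto
  qed (use assms in auto)
qed

lemma sin_neighbours:
  fixes t :: real
  shows "sin (real i * t) + sin (real (i + 2) * t) = 2 * cos t * sin (real (i + 1) * t)"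
proof -
  have "real (i + 2) * t = real (i + 1) * t + t" "real i * t = real (i + 1) * t - t"
    by (auto simp: algebra_simps)
  then show ?thesis by (simp only: sin_add sin_diff) simp
qed

text \<open>The eigenvector equation at the trivalent node of the tree with arms of 1, 2 and \<open>n - 1\<close>
  nodes; the hypothesis says $1/\sin 2t = \cot 3t + \cot nt$.\<close>

lemma trivalent_node:
  fixes t n :: real
  assumes "sin (3 * t) * sin (n * t) = sin (2 * t) * sin ((n + 3) * t)"
    and nz: "sin (2 * t) \<noteq> 0" "sin (3 * t) \<noteq> 0" "sin (n * t) \<noteq> 0"
  shows "sin (2 * t) / sin (3 * t) + sin ((n - 1) * t) / sin (n * t) + sin t / sin (2 * t) = 2 * cos t"
proof -
  have s: "sin t \<noteq> 0" "cos t \<noteq> 0" using nz(1) by (auto simp: sin_double)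
  have 1: "sin (2 * t) = sin (3 * t) * cos t - cos (3 * t) * sin t"
    using sin_diff[of "3 * t" t] by simp
  have 2: "sin ((n - 1) * t) = sin (n * t) * cos t - cos (n * t) * sin t"
    using sin_diff[of "n * t" t] by (simp add: algebra_simps)
  have 3: "sin ((n + 3) * t) = sin (n * t) * cos (3 * t) + cos (n * t) * sin (3 * t)"
    using sin_add[of "n * t" "3 * t"] by (simp add: algebra_simps)
  have k: "cos (3 * t) / sin (3 * t) + cos (n * t) / sin (n * t) = 1 / sin (2 * t)"
    (is "?l = _")
  proof -
    have "?l = (sin (n * t) * cos (3 * t) + cos (n * t) * sin (3 * t)) / (sin (3 * t) * sin (n * t))"
      using nz by (simp add: field_simps)
    moreover have "sin (n * t) * cos (3 * t) + cos (n * t) * sin (3 * t) \<noteq> 0"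
      using assms(1) nz unfolding 3 by (metis mult_eq_0_iff)
    ultimately show ?thesis
      using assms(1)[unfolded 3] nz(1) by (metis divide_divide_eq_left divide_self mult.commute)
  qed
  have "sin (2 * t) / sin (3 * t) = cos t - sin t * (cos (3 * t) / sin (3 * t))"
    using nz unfolding 1 by (simp add: field_simps)
  moreover have "sin ((n - 1) * t) / sin (n * t) = cos t - sin t * (cos (n * t) / sin (n * t))"
    using nz unfolding 2 by (simp add: field_simps)
  ultimately have "sin (2 * t) / sin (3 * t) + sin ((n - 1) * t) / sin (n * t) + sin t / sin (2 * t)
      = 2 * cos t - sin t * (cos (3 * t) / sin (3 * t) + cos (n * t) / sin (n * t)) + sin t / sin (2 * t)"
    by (simp add: algebra_simps)
  then show ?thesis unfolding k by simp
qed

lemma cos_36_minus_cos_72: "cos (pi / 5) - cos (2 * pi / 5) = 1 / 2"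
proof -
  define c where "c = cos (pi / 5)"
  have c2: "cos (2 * pi / 5) = 2 * c\<^sup>2 - 1"
    using cos_double_cos[of "pi / 5"] by (simp add: c_def)
  have c4: "cos (4 * pi / 5) = 2 * (2 * c\<^sup>2 - 1)\<^sup>2 - 1"
    using cos_double_cos[of "2 * pi / 5"] c2 by simp
  have "cos (4 * pi / 5) = - c"
    using cos_pi_minus[of "pi / 5"] by (simp add: c_def)
  then have "(c + 1) * (2 * c - 1) * (4 * c\<^sup>2 - 2 * c - 1) = 0"
    unfolding c4 by (simp add: algebra_simps power2_eq_square power4_eq_xxxx)
  moreover have "1 / 2 < c"
    using cos_monotone_0_pi[of "pi / 5" "pi / 3"] by (simp add: c_def cos_60)
  ultimately have "4 * c\<^sup>2 - 2 * c - 1 = 0" by auto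
  then show ?thesis unfolding c2 c_def[symmetric] by simp
qed

text \<open>This is where the numbers 12, 18 and 30 enter. For h = 12 all angles are multiples of 30
  or 45 degrees; for h = 18 the angles 2 \<theta> and 7 \<theta> are complementary; for h = 30 a
  product formula reduces the claim to the pentagon identity above.\<close>

lemma trivalent_identity:
  assumes "r \<in> {6, 7, 8}"
  shows "sin (3 * theta (E r)) * sin (real (r - 3) * theta (E r))
    = sin (2 * theta (E r)) * sin ((real (r - 3) + 3) * theta (E r))"
proof -
  consider "r = 6" | "r = 7" | "r = 8" using assms by auto
  then show ?thesis
  proof cases
    case 1
    then show ?thesis by (simp add: sin_45 sin_30)
  next
    case 2
    have "sin (7 * pi / 18) = cos (2 * pi / 18)"
      by (simp add: sin_cos_eq algebra_simps)
    moreover have "sin (4 * pi / 18) = 2 * sin (2 * pi / 18) * cos (2 * pi / 18)"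
      using sin_double[of "2 * pi / 18"] by simp
    ultimately show ?thesis using 2 by (simp add: sin_30)
  next
    case 3
    have "sin (2 * pi / 30) * sin (8 * pi / 30) = (cos (pi / 5) - cos (pi / 3)) / 2"
      using sin_times_sin[of "2 * pi / 30" "8 * pi / 30"] by (simp add: cos_minus[of "pi/5"])
    moreover have "sin (3 * pi / 30) = cos (2 * pi / 5)"
      by (simp add: sin_cos_eq algebra_simps)
    ultimately show ?thesis using 3 cos_36_minus_cos_72 by (simp add: sin_30 cos_60)
  qed
qed

text \<open>Inside an arm the equation is the three-term recursion of sines, and at its free end it
  holds because sin 0 = 0. The value \<theta> = \<pi>/h matters only at the other end: the sine
  vanishes one step beyond the chain in type A, reaches its maximum at the double bond or the fork
  in types B, C, D, and satisfies a special identity in types E and F.\<close>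

lemma finite_marks_eigen:
  assumes "dynkin_ok b" "\<not> affine_type b" "i < num_nodes b"
  shows "nbr_sum (edges b) i (\<lambda>j. bond b i j * finite_marks b j)
    = 2 * cos (theta b) * finite_marks b i"
proof -
  define t where "t = theta b"
  define S where "S m = sin (real m * t)" for m
  have S0: "S 0 = 0" by (simp add: S_def)
  have rec: "S m + S (Suc (Suc m)) = 2 * cos t * S (Suc m)" for m
    using sin_neighbours[of m t] by (simp add: S_def)
  have h: "0 < cox b" using assms by (cases b) auto
  have S_refl: "S m = S m'" if "m + m' = cox b" for m m'
  proof -
    have "real m * t = pi - real m' * t"
      using that h by (simp add: t_def field_simps flip: of_nat_add distrib_left)
    then show ?thesis by (simp add: S_def)
  qed
  \<comment> \<open>The angle m t is a right angle here, which is how the chains of types B, C and D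
    end.\<close>
  have S_half: "S m = 1" "S (m - 1) = cos t" if "2 * m = cox b" for m
  proof -
    have "m \<noteq> 0" using that h by auto
    have m: "real m * t = pi / 2"
      using that[symmetric] \<open>m \<noteq> 0\<close> by (simp add: t_def)
    show "S m = 1" unfolding S_def m by simp
    have "real (m - 1) = real m - 1"
      using \<open>m \<noteq> 0\<close> by (simp add: of_nat_diff)
    then have "real (m - 1) * t = pi / 2 - t"
      by (simp only: left_diff_distrib m)
    then show "S (m - 1) = cos t" by (simp add: S_def cos_sin_eq)
  qed
  have eq: "cos (theta b) = cos t" by (simp add: t_def)
  show ?thesis
  proof (cases b)
    case (A r)
    then obtain s where r: "r = Suc s"
      using assms by (cases r) auto
    have m: "finite_marks b j = S (Suc j)" for j
      by (simp add: A S_def t_def)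
    have Sr: "S (Suc (Suc s)) = 0" using S_refl[of "Suc (Suc s)" 0] S0 by (simp add: A r)
    consider "i < s" | "i = s" using assms A r by force
    then show ?thesis
    proof cases
      case 1
      then show ?thesis using rec[of i] S0 unfolding m eq by (cases i) (simp_all add: A r bond_def)
    next
      case 2
      then show ?thesis using rec[of i] S0 Sr unfolding m eq by (cases s) (simp_all add: A r bond_def)
    qed
  next
    case (B r)
    then obtain s where r: "r = s + 2"
      using assms le_Suc_ex[of 2 r] by (auto simp: add.commute)
    have m: "finite_marks b j = (if j = Suc s then 1 / 2 else S (Suc j))" for j
      by (simp add: B r S_def t_def)
    have Sr: "S (Suc (Suc s)) = 1" "S (Suc s) = cos t" using S_half[of r] by (simp_all add: B r)
    consider "i < s" | "i = s" | "i = Suc s" using assms B r by force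
    then show ?thesis
    proof cases
      case 1
      then show ?thesis using rec[of i] S0 unfolding m eq by (cases i) (simp_all add: B r bond_def)
    next
      case 2
      then show ?thesis using rec[of i] S0 Sr unfolding m eq by (cases s) (simp_all add: B r bond_def)
    next
      case 3
      then show ?thesis using Sr unfolding m eq by (simp add: B r bond_def)
    qed
  next
    case (C r)
    then obtain s where r: "r = s + 2"
      using assms le_Suc_ex[of 2 r] by (auto simp: add.commute)
    have m: "finite_marks b j = S (Suc j)" for j
      by (simp add: C S_def t_def)
    have Sr: "S (Suc (Suc s)) = 1" "S (Suc s) = cos t" using S_half[of r] by (simp_all add: C r)
    consider "i < s" | "i = s" | "i = Suc s" using assms C r by force
    then show ?thesis
    proof cases
      case 1
      then show ?thesis using rec[of i] S0 unfolding m eq by (cases i) (simp_all add: C r bond_def)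
    next
      case 2
      then show ?thesis using rec[of i] S0 unfolding m eq by (cases s) (simp_all add: C r bond_def)
    next
      case 3
      then show ?thesis using Sr unfolding m eq by (simp add: C r bond_def)
    qed
  next
    case (D r)
    then obtain s where r: "r = s + 4"
      using assms le_Suc_ex[of 4 r] by (auto simp: add.commute)
    have m: "finite_marks b j = (if s + 2 \<le> j then 1 / 2 else S (Suc j))" for j
      by (simp add: D r S_def t_def)
    have Sr: "S (Suc (Suc (Suc s))) = 1" "S (Suc (Suc s)) = cos t"
      using S_half[of "s + 3"] by (simp_all add: D r eval_nat_numeral)
    consider "i < s + 1" | "i = s + 1" | "i = s + 2" | "i = s + 3"
      using assms D r by force
    then show ?thesis
    proof cases
      case 1
      then show ?thesis using rec[of i] S0 unfolding m eq by (cases i) (simp_all add: D r bond_def)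
    next
      case 2
      then show ?thesis using rec[of i] Sr unfolding m eq by (simp add: D r bond_def)
    next
      case 3
      then show ?thesis using Sr unfolding m eq by (simp add: D r bond_def)
    next
      case 4
      then show ?thesis using Sr unfolding m eq by (simp add: D r bond_def)
    qed
  next
    case (E r)
    have r: "r \<in> {6, 7, 8}" using assms E by auto
    have s: "sin (2 * t) \<noteq> 0" "sin (3 * t) \<noteq> 0" "sin (real (r - 3) * t) \<noteq> 0"
      using r E sin_mult_theta_pos[of 2 "cox b"] sin_mult_theta_pos[of 3 "cox b"]
        sin_mult_theta_pos[of "r - 3" "cox b"] by (auto simp: t_def)
    have "sin (2 * t) / sin (3 * t) + sin ((real (r - 3) - 1) * t) / sin (real (r - 3) * t)
        + sin t / sin (2 * t) = 2 * cos t"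
      using trivalent_identity[OF r] s by (intro trivalent_node) (auto simp: t_def E)
    then have br: "S 2 / S 3 + S (r - 4) / S (r - 3) + S 1 / S 2 = 2 * cos t"
      using r by (auto simp: S_def)
    define X Y Z where "X k = S k / S 3" and "Y k = S k / S (r - 3)" and "Z k = S k / S 2" for k
    have m: "finite_marks b j = (if j = r - 1 then Z 1 else if j \<le> 2 then X (j + 1)
        else Y (r - 1 - j))" for j
      by (simp add: E S_def t_def X_def Y_def Z_def)
    have unit: "X 3 = 1" "Y (r - 3) = 1" "Z 2 = 1"
      using s by (auto simp: S_def X_def Y_def Z_def)
    have branch: "X 2 + Y (r - 4) + Z 1 = 2 * cos t"
      using br by (simp add: X_def Y_def Z_def)
    have rec1: "S 2 / a = 2 * cos t * (S 1 / a)" for a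
      using rec[of 0] S0 by (simp add: eval_nat_numeral)
    have rec2: "S (k - 1) / a + S (k + 1) / a = 2 * cos t * (S k / a)" if "1 < k" for k a
      using rec[of "k - 1"] that by (simp flip: add_divide_distrib)
    note recs = rec1 rec2[of 2] rec2[of 3] rec2[of 4]
    have X: "X 2 = 2 * cos t * X 1" "X 1 + X 3 = 2 * cos t * X 2"
      using recs(1,2)[of "S 3"] by (simp_all add: X_def)
    have Y: "Y 2 = 2 * cos t * Y 1" "Y 1 + Y 3 = 2 * cos t * Y 2" "Y 2 + Y 4 = 2 * cos t * Y 3"
      "Y 3 + Y 5 = 2 * cos t * Y 4"
      using recs[of "S (r - 3)"] by (simp_all add: Y_def)
    have Z: "Z 2 = 2 * cos t * Z 1"
      using recs(1)[of "S 2"] by (simp add: Z_def)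
    consider "r = 6" | "r = 7" | "r = 8" using r by auto
    then show ?thesis
    proof cases
      case 1
      then have "i \<in> {0, 1, 2, 3, 4, 5}" using assms E by auto
      moreover have "X 2 + Y 2 + Z 1 = 2 * cos t" "Y 3 = 1"
        using branch unit(2) 1 by simp_all
      ultimately show ?thesis
        using unit(1,3) X Y Z unfolding m eq
        by (elim insertE emptyE; simp add: E 1 bond_def flip: One_nat_def)
    next
      case 2
      then have "i \<in> {0, 1, 2, 3, 4, 5, 6}" using assms E by auto
      moreover have "X 2 + Y 3 + Z 1 = 2 * cos t" "Y 4 = 1"
        using branch unit(2) 2 by simp_all
      ultimately show ?thesis
        using unit(1,3) X Y Z unfolding m eq
        by (elim insertE emptyE; simp add: E 2 bond_def flip: One_nat_def)
    next
      case 3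
      then have "i \<in> {0, 1, 2, 3, 4, 5, 6, 7}" using assms E by auto
      moreover have "X 2 + Y 4 + Z 1 = 2 * cos t" "Y 5 = 1"
        using branch unit(2) 3 by simp_all
      ultimately show ?thesis
        using unit(1,3) X Y Z unfolding m eq
        by (elim insertE emptyE; simp add: E 3 bond_def flip: One_nat_def)
    qed
  next
    case F4
    have t: "t = pi / 12" by (simp add: t_def F4)
    have S: "S 2 = 1 / 2" "S 3 = sqrt 2 / 2"
      by (simp_all add: S_def t sin_30 sin_45)
    \<comment> \<open>The factor \<open>g\<close> fits the sines of the short arm to both sides of
      the double bond: node 1 needs \<open>S 2 * g = S 3 / 2\<close>, node 2 needs
      \<open>S 3 * g = S 2\<close>. The two agree because the square of \<open>S 3\<close> is twice
      that of \<open>S 2\<close>.\<close>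
    define g where "g = S 3 / (2 * S 2)"
    have g: "S 2 * g = S 3 / 2" "S 3 * g = S 2" by (simp_all add: g_def S)
    have m: "finite_marks b j = (if j \<le> 1 then S (j + 1) else S (4 - j) * g)" for j
      by (simp add: F4 S_def t_def g_def)
    have rec': "S 2 = 2 * cos t * S 1" "S 1 + S 3 = 2 * cos t * S 2"
      using rec[of 0] rec[of 1] S0 by (simp_all add: eval_nat_numeral)
    have "i \<in> {0, 1, 2, 3}" using assms F4 by auto
    moreover have "S 1 * g + S 2 = 2 * cos t * (S 2 * g)"
      using arg_cong[OF rec'(2), of "\<lambda>x. x * g"] g by (simp add: algebra_simps)
    moreover have "S 2 * g = 2 * cos t * (S 1 * g)"
      using arg_cong[OF rec'(1), of "\<lambda>x. x * g"] by (simp add: algebra_simps)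
    ultimately show ?thesis
      using rec' g unfolding m eq by (elim insertE emptyE; simp add: F4 bond_def flip: One_nat_def)
  qed (use assms in auto)
qed

definition marks :: "dynkin \<Rightarrow> nat \<Rightarrow> real" where
  "marks b = (if affine_type b then affine_marks b else finite_marks b)"

definition marks_eigenvalue :: "dynkin \<Rightarrow> real" where
  "marks_eigenvalue b = (if affine_type b then 2 else 2 * cos (theta b))"

lemma positive_eigenvector_marks:
  assumes "dynkin_ok b"
  shows "positive_eigenvector (num_nodes b) (adj b) (short_weight b) (marks b) (marks_eigenvalue b)"
proof
  fix i assume i: "i < num_nodes b"
  show "0 < marks b i"
    using assms i by (simp add: marks_def affine_marks_pos finite_marks_pos)
  show "(\<Sum>j<num_nodes b. adj b i j * marks b j) = marks_eigenvalue b * marks b i"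
    using assms i unfolding adj_row_sum[OF assms i]
    by (simp add: marks_def marks_eigenvalue_def affine_marks_eigen finite_marks_eigen)
qed (use short_weight_adj in \<open>simp_all add: adj_nonneg short_weight_pos\<close>)

lemma largest_eigenvalue_eq:
  "dynkin_ok b \<Longrightarrow> largest_eigenvalue b = marks_eigenvalue b"
  by (rule largest_eigenvalue_eqI[OF _ positive_eigenvector_marks])

lemma largest_eigenvalue_finite_less:
  assumes "dynkin_ok b" "\<not> affine_type b"
  shows "largest_eigenvalue b < 2"
proof -
  have "2 \<le> cox b" using assms by (cases b) auto
  then have "cos (theta b) < cos 0"
    by (intro cos_monotone_0_pi) (auto simp: field_simps)
  then show ?thesis using assms by (simp add: largest_eigenvalue_eq marks_eigenvalue_def)
qed

section \<open>The Coxeter element\<close>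

text \<open>Real entries allow the integer matrix to act on the trigonometric orbit that gives the
  lower bound for its order.\<close>

definition coxeter_real :: "dynkin \<Rightarrow> real mat" where
  "coxeter_real b = map_mat real_of_int (coxeter_element b)"

text \<open>The orbits of the Coxeter element are the solutions of this relation: it applies the
  reflections from the last node to the first, so that at node \<open>i\<close> the larger neighbours already
  have their new values.\<close>

definition mesh :: "dynkin \<Rightarrow> (nat \<Rightarrow> nat \<Rightarrow> real) \<Rightarrow> bool" where
  "mesh b x \<longleftrightarrow> (\<forall>t. \<forall>i<num_nodes b. x (Suc t) i + x t i
     = nbr_sum (edges b) i (\<lambda>q. bond b q i * (if q < i then x t q else x (Suc t) q)))"

lemma meshD:
  "mesh b x \<Longrightarrow> i < num_nodes b \<Longrightarrow> x (Suc t) i + x t i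
     = nbr_sum (edges b) i (\<lambda>q. bond b q i * (if q < i then x t q else x (Suc t) q))"
  by (simp add: mesh_def)

lemma simple_reflection_carrier [simp]:
  "simple_reflection b i \<in> carrier_mat (num_nodes b) (num_nodes b)"
  by (simp add: simple_reflection_def)

lemma foldr_reflections_carrier [simp]:
  "foldr (\<lambda>i M. simple_reflection b i * M) is (1\<^sub>m (num_nodes b))
     \<in> carrier_mat (num_nodes b) (num_nodes b)"
proof (induction "is")
  case (Cons i "is")
  then show ?case using mult_carrier_mat[OF simple_reflection_carrier] by simp
qed simp

lemma coxeter_real_carrier [simp]: "coxeter_real b \<in> carrier_mat (num_nodes b) (num_nodes b)"
  by (simp add: coxeter_real_def coxeter_element_def)

lemma coxeter_real_dim [simp]:
  "dim_row (coxeter_real b) = num_nodes b" "dim_col (coxeter_real b) = num_nodes b"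
  using carrier_matD[OF coxeter_real_carrier] by auto

lemma simple_reflection_apply:
  assumes "v \<in> carrier_vec (num_nodes b)" "p < num_nodes b" "i < num_nodes b"
  shows "(map_mat real_of_int (simple_reflection b i) *\<^sub>v v) $ p
    = (if p = i then - (v $ i) + (\<Sum>q<num_nodes b. adj b q i * v $ q) else v $ p)"
proof -
  let ?n = "num_nodes b"
  have "(map_mat real_of_int (simple_reflection b i) *\<^sub>v v) $ p
    = (\<Sum>q<?n. ((if p = q then 1 else 0) - (if p = i then (if q = i then 2 else 0) - adj b q i else 0)) * v $ q)"
    using assms
    by (auto simp: simple_reflection_def scalar_prod_def lessThan_atLeast0 cartan_adj intro!: sum.cong)
  also have "\<dots> = (\<Sum>q<?n. (if q = p then v $ q else 0)
      + (if p = i then adj b q i * v $ q - (if q = i then 2 * v $ q else 0) else 0))"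
    by (intro sum.cong) (auto simp: algebra_simps)
  also have "\<dots> = (if p = i then - (v $ i) + (\<Sum>q<?n. adj b q i * v $ q) else v $ p)"
    using assms by (auto simp: sum.distrib sum_subtractf)
  finally show ?thesis .
qed

lemma coxeter_real_step:
  assumes ok: "dynkin_ok b" and v: "v \<in> carrier_vec (num_nodes b)"
    and w: "w = coxeter_real b *\<^sub>v v" and i: "i < num_nodes b"
  shows "w $ i + v $ i
    = nbr_sum (edges b) i (\<lambda>q. bond b q i * (if q < i then v $ q else w $ q))"
proof -
  let ?n = "num_nodes b"
  define R where "R j = foldr (\<lambda>i M. simple_reflection b i * M) [j..<?n] (1\<^sub>m ?n)" for j
  define y where "y j = map_mat real_of_int (R j) *\<^sub>v v" for j
  have Rc: "R j \<in> carrier_mat ?n ?n" for j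
    by (simp add: R_def)
  have yc: "y j \<in> carrier_vec ?n" for j
    using Rc[of j] v by (simp add: y_def)
  have yn: "y ?n = v"
    using v by (simp add: y_def R_def of_int_hom.mat_hom_one)
  have ystep: "y j = map_mat real_of_int (simple_reflection b j) *\<^sub>v y (Suc j)" if "j < ?n" for j
  proof -
    have "R j = simple_reflection b j * R (Suc j)"
      using that by (simp add: R_def upt_conv_Cons)
    then have "y j = (map_mat real_of_int (simple_reflection b j) * map_mat real_of_int (R (Suc j))) *\<^sub>v v"
      unfolding y_def using of_int_hom.mat_hom_mult[OF simple_reflection_carrier Rc] by metis
    also have "\<dots> = map_mat real_of_int (simple_reflection b j) *\<^sub>v y (Suc j)"
      unfolding y_def using Rc[of "Suc j"] v by (intro assoc_mult_mat_vec[of _ ?n ?n _ ?n]) auto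
    finally show ?thesis .
  qed
  have ycoord: "y j $ p = (if p = j then - (y (Suc j) $ j) + (\<Sum>q<?n. adj b q j * y (Suc j) $ q)
      else y (Suc j) $ p)" if "j < ?n" "p < ?n" for j p
    unfolding ystep[OF that(1)] using simple_reflection_apply[OF yc that(2,1)] .
  have w0: "w = y 0"
    by (simp add: w y_def R_def coxeter_real_def coxeter_element_def)
  \<comment> \<open>Coordinate \<open>p\<close> changes exactly once, when the reflection at
    \<open>p\<close> is applied: before that it has the value in \<open>v\<close>, afterwards the
    value in \<open>w\<close>.\<close>
  have early: "p < j \<Longrightarrow> y j $ p = v $ p" if "j \<le> ?n" for j p
    using that
  proof (induction rule: inc_induct)
    case base
    then show ?case by (simp add: yn)
  next
    case (step j)
    then show ?case using ycoord[of j p] by auto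
  qed
  have late: "j \<le> p \<Longrightarrow> y j $ p = w $ p" if "p < ?n" for j p
  proof (induction j)
    case 0
    then show ?case by (simp add: w0)
  next
    case (Suc j)
    then show ?case using ycoord[of j p] that by auto
  qed
  have "w $ i = - (y (Suc i) $ i) + (\<Sum>q<?n. adj b q i * y (Suc i) $ q)"
    using late[OF i, of i] ycoord[OF i i] by simp
  also have "y (Suc i) $ i = v $ i"
    using early[of "Suc i" i] i by simp
  also have "(\<Sum>q<?n. adj b q i * y (Suc i) $ q)
      = (\<Sum>q<?n. adj b q i * (if q < i then v $ q else w $ q))"
  proof (intro sum.cong refl)
    fix q assume q: "q \<in> {..<?n}"
    consider "q < i" | "q = i" | "i < q" by linarith
    then show "adj b q i * y (Suc i) $ q = adj b q i * (if q < i then v $ q else w $ q)"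
    proof cases
      case 1
      then show ?thesis using early[of "Suc i" q] i by simp
    next
      case 2
      then show ?thesis using i by (simp add: adj_eq)
    next
      case 3
      then show ?thesis using late[of q "Suc i"] q by simp
    qed
  qed
  finally show ?thesis
    unfolding adj_column_sum[OF ok i] by simp
qed

text \<open>The relation determines \<open>w\<close> from the last node down to the first.\<close>

lemma mesh_step_unique:
  assumes ok: "dynkin_ok b"
    and w: "\<And>i. i < num_nodes b \<Longrightarrow> w i + v i
      = nbr_sum (edges b) i (\<lambda>q. bond b q i * (if q < i then v q else w q))"
    and w': "\<And>i. i < num_nodes b \<Longrightarrow> w' i + v i
      = nbr_sum (edges b) i (\<lambda>q. bond b q i * (if q < i then v q else w' q))"
    and i: "i < num_nodes b"
  shows "w i = w' i"
  using i
proof (induction "num_nodes b - i" arbitrary: i rule: less_induct)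
  case less
  have "nbr_sum (edges b) i (\<lambda>q. bond b q i * (if q < i then v q else w q))
      = nbr_sum (edges b) i (\<lambda>q. bond b q i * (if q < i then v q else w' q))"
  proof (rule nbr_sum_cong)
    fix u z assume uz: "(u, z) \<in> set (edges b)"
    have "w q = w' q" if "i < q" "q < num_nodes b" for q
      using less that by simp
    then have "\<not> q < i \<Longrightarrow> q \<noteq> i \<Longrightarrow> q < num_nodes b \<Longrightarrow> w q = w' q" for q
      by simp
    then show "(u = i \<longrightarrow> bond b z i * (if z < i then v z else w z) = bond b z i * (if z < i then v z else w' z)) \<and>
        (z = i \<longrightarrow> bond b u i * (if u < i then v u else w u) = bond b u i * (if u < i then v u else w' u))"
      using edges_range[OF ok uz] by auto
  qed
  then show ?case using w[OF less.prems] w'[OF less.prems] by simp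
qed

lemma pow_mat_mult_vec:
  assumes M: "M \<in> carrier_mat n n" and v: "v \<in> carrier_vec n"
  shows "(M ^\<^sub>m t) *\<^sub>v v = ((\<lambda>v. M *\<^sub>v v) ^^ t) v"
  using v
proof (induction t arbitrary: v)
  case 0
  then show ?case using M by simp
next
  case (Suc t)
  have "(M ^\<^sub>m Suc t) *\<^sub>v v = M ^\<^sub>m t *\<^sub>v (M *\<^sub>v v)"
    using M Suc.prems pow_carrier_mat[OF M] by (simp add: assoc_mult_mat_vec[of _ n n _ n])
  also have "\<dots> = ((\<lambda>v. M *\<^sub>v v) ^^ Suc t) v"
    using Suc.IH[of "M *\<^sub>v v"] M Suc.prems by (simp add: funpow_swap1)
  finally show ?case .
qed

lemma mesh_orbit:
  assumes ok: "dynkin_ok b" and v: "v \<in> carrier_vec (num_nodes b)"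
  shows "mesh b (\<lambda>t i. (coxeter_real b ^\<^sub>m t *\<^sub>v v) $ i)"
  unfolding mesh_def
proof (intro allI impI)
  fix t i assume "i < num_nodes b"
  moreover have "coxeter_real b ^\<^sub>m t *\<^sub>v v \<in> carrier_vec (num_nodes b)"
    using pow_carrier_mat[OF coxeter_real_carrier] v by (rule mult_mat_vec_carrier)
  moreover have "coxeter_real b ^\<^sub>m Suc t *\<^sub>v v = coxeter_real b *\<^sub>v (coxeter_real b ^\<^sub>m t *\<^sub>v v)"
    using pow_mat_mult_vec[OF coxeter_real_carrier v] by (simp del: pow_mat.simps)
  ultimately show "(coxeter_real b ^\<^sub>m Suc t *\<^sub>v v) $ i + (coxeter_real b ^\<^sub>m t *\<^sub>v v) $ i
      = nbr_sum (edges b) i (\<lambda>q. bond b q i * (if q < i then (coxeter_real b ^\<^sub>m t *\<^sub>v v) $ q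
          else (coxeter_real b ^\<^sub>m Suc t *\<^sub>v v) $ q))"
    using coxeter_real_step[OF ok] by blast
qed

lemma mesh_eq_orbit:
  assumes ok: "dynkin_ok b" and x: "mesh b x"
  shows "coxeter_real b ^\<^sub>m t *\<^sub>v vec (num_nodes b) (x 0) = vec (num_nodes b) (x t)"
proof (induction t)
  case 0
  then show ?case by (simp add: one_mult_mat_vec[of _ "num_nodes b"])
next
  case (Suc t)
  let ?v = "vec (num_nodes b) (x t)"
  let ?w = "coxeter_real b *\<^sub>v ?v"
  have "?w $ i = x (Suc t) i" if i: "i < num_nodes b" for i
  proof (rule mesh_step_unique[OF ok _ meshD[OF x] i])
    fix i assume i: "i < num_nodes b"
    have "?w $ i + ?v $ i = nbr_sum (edges b) i (\<lambda>q. bond b q i * (if q < i then ?v $ q else ?w $ q))"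
      by (rule coxeter_real_step[OF ok _ refl i]) simp
    also have "\<dots> = nbr_sum (edges b) i (\<lambda>q. bond b q i * (if q < i then x t q else ?w $ q))"
      using i by (intro nbr_sum_cong) auto
    finally show "?w $ i + x t i = \<dots>"
      using i by simp
  qed
  then have "?w = vec (num_nodes b) (x (Suc t))"
    by (intro eq_vecI) (use coxeter_real_carrier[of b] in auto)
  then show ?case
    using Suc.IH pow_mat_mult_vec[OF coxeter_real_carrier vec_carrier[of "num_nodes b" "x 0"]]
    by (simp del: pow_mat.simps)
qed

text \<open>From here on the order of the matrix is a question about periods of sequences. One
  direction starts the orbit at \<open>x 0\<close>, the other tests the power on the orbits of the
  unit vectors.\<close>

lemma coxeter_element_pow_eq_1_iff:
  assumes ok: "dynkin_ok b"
  shows "coxeter_element b ^\<^sub>m h = 1\<^sub>m (num_nodes b)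
    \<longleftrightarrow> (\<forall>x. mesh b x \<longrightarrow> (\<forall>i<num_nodes b. x h i = x 0 i))"
proof
  let ?n = "num_nodes b"
  have c: "coxeter_element b \<in> carrier_mat ?n ?n"
    by (simp add: coxeter_element_def)
  have hom: "map_mat real_of_int (coxeter_element b ^\<^sub>m h) = coxeter_real b ^\<^sub>m h"
    unfolding coxeter_real_def by (rule of_int_hom.mat_hom_pow[OF c])
  {
    assume "coxeter_element b ^\<^sub>m h = 1\<^sub>m ?n"
    then have 1: "coxeter_real b ^\<^sub>m h = 1\<^sub>m ?n"
      using hom by (simp add: of_int_hom.mat_hom_one)
    show "\<forall>x. mesh b x \<longrightarrow> (\<forall>i<?n. x h i = x 0 i)"
    proof (intro allI impI)
      fix x i assume "mesh b x" "i < ?n"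
      then show "x h i = x 0 i"
        using mesh_eq_orbit[OF ok, of x h] unfolding 1 by (metis index_vec one_mult_mat_vec vec_carrier)
    qed
  }
  {
    assume per: "\<forall>x. mesh b x \<longrightarrow> (\<forall>i<?n. x h i = x 0 i)"
    have P: "coxeter_real b ^\<^sub>m h \<in> carrier_mat ?n ?n"
      by (rule pow_carrier_mat) simp
    have "coxeter_real b ^\<^sub>m h = 1\<^sub>m ?n"
    proof (rule eq_matI)
      fix i j assume "i < dim_row (1\<^sub>m ?n)" "j < dim_col (1\<^sub>m ?n)"
      then have ij: "i < ?n" "j < ?n" by simp_all
      let ?e = "unit_vec ?n j"
      have "(coxeter_real b ^\<^sub>m h *\<^sub>v ?e) $ i = (coxeter_real b ^\<^sub>m 0 *\<^sub>v ?e) $ i"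
        using per[rule_format, OF mesh_orbit[OF ok unit_vec_carrier] ij(1)] .
      then have "(coxeter_real b ^\<^sub>m h *\<^sub>v ?e) $ i = ?e $ i"
        by (simp add: one_mult_mat_vec[of _ ?n])
      then show "(coxeter_real b ^\<^sub>m h) $$ (i, j) = 1\<^sub>m ?n $$ (i, j)"
        using ij P by simp
    qed (use P in auto)
    then have "map_mat real_of_int (coxeter_element b ^\<^sub>m h) = map_mat real_of_int (1\<^sub>m ?n)"
      unfolding hom by (simp add: of_int_hom.mat_hom_one)
    then show "coxeter_element b ^\<^sub>m h = 1\<^sub>m ?n"
      by (rule of_int_hom.mat_hom_inj)
  }
qed

text \<open>With \<open>\<eta>\<close> increasing by one along every edge, $e^{i(2t - \eta_j)\theta}$ times the
  left eigenvector of the adjacency matrix solves the mesh relation; this is its real part.\<close>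

lemma mesh_cos:
  fixes \<eta> :: "nat \<Rightarrow> real"
  assumes ok: "dynkin_ok b" and ev: "marks_eigenvalue b = 2 * cos \<theta>"
    and \<eta>: "\<And>u v. (u, v) \<in> set (edges b) \<Longrightarrow> u < v \<and> \<eta> v = \<eta> u + 1"
  shows "mesh b (\<lambda>t i. short_weight b i * marks b i * cos ((2 * real t - \<eta> i) * \<theta>))"
  unfolding mesh_def
proof (intro allI impI)
  fix t i assume i: "i < num_nodes b"
  interpret positive_eigenvector "num_nodes b" "adj b" "short_weight b" "marks b" "marks_eigenvalue b"
    by (rule positive_eigenvector_marks[OF ok])
  let ?x = "\<lambda>t i. short_weight b i * marks b i * cos ((2 * real t - \<eta> i) * \<theta>)"
  define c where "c = cos ((2 * real t - \<eta> i + 1) * \<theta>)"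
  have "nbr_sum (edges b) i (\<lambda>q. bond b q i * (if q < i then ?x t q else ?x (Suc t) q))
      = nbr_sum (edges b) i (\<lambda>q. c * (bond b q i * (short_weight b q * marks b q)))"
  proof (rule nbr_sum_cong)
    fix u v assume "(u, v) \<in> set (edges b)"
    then have uv: "u < v" "\<eta> v = \<eta> u + 1" using \<eta> by auto
    then show "(u = i \<longrightarrow> bond b v i * (if v < i then ?x t v else ?x (Suc t) v)
          = c * (bond b v i * (short_weight b v * marks b v))) \<and>
        (v = i \<longrightarrow> bond b u i * (if u < i then ?x t u else ?x (Suc t) u)
          = c * (bond b u i * (short_weight b u * marks b u)))"
      by (auto simp: c_def add_ac diff_diff_eq)
  qed
  also have "\<dots> = c * nbr_sum (edges b) i (\<lambda>q. bond b q i * (short_weight b q * marks b q))"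
    by (rule nbr_sum_mult)
  also have "\<dots> = c * (2 * cos \<theta> * (short_weight b i * marks b i))"
    unfolding adj_column_sum[OF ok i, symmetric] left_eigen[OF i] ev ..
  also have "\<dots> = ?x (Suc t) i + ?x t i"
  proof -
    have "(2 * real (Suc t) - \<eta> i) * \<theta> = (2 * real t - \<eta> i + 1) * \<theta> + \<theta>"
      "(2 * real t - \<eta> i) * \<theta> = (2 * real t - \<eta> i + 1) * \<theta> - \<theta>"
      by (simp_all add: algebra_simps)
    then have "cos ((2 * real (Suc t) - \<eta> i) * \<theta>) + cos ((2 * real t - \<eta> i) * \<theta>) = 2 * c * cos \<theta>"
      unfolding c_def by (simp only: cos_add cos_diff)
    then show ?thesis
      by (metis (no_types, opaque_lifting) distrib_left mult.assoc mult.commute)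
  qed
  finally show "?x (Suc t) i + ?x t i
      = nbr_sum (edges b) i (\<lambda>q. bond b q i * (if q < i then ?x t q else ?x (Suc t) q))"
    by simp
qed

text \<open>Minimality comes from the cosine orbit. As \<eta> vanishes at node 0, the value there is
  a positive constant times cos (2 t \<theta>), and its return to the initial value at time m forces
  m to be a multiple of h.\<close>

lemma coxeter_number_eqI:
  fixes \<eta> :: "nat \<Rightarrow> real"
  assumes ok: "dynkin_ok b" "\<not> affine_type b"
    and \<eta>: "\<And>u v. (u, v) \<in> set (edges b) \<Longrightarrow> u < v \<and> \<eta> v = \<eta> u + 1" "\<eta> 0 = 0"
    and per: "\<And>x i. mesh b x \<Longrightarrow> i < num_nodes b \<Longrightarrow> x (cox b) i = x 0 i"
  shows "coxeter_number b = cox b"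
  unfolding coxeter_number_def
proof (rule Least_equality)
  have h: "0 < cox b" using ok by (cases b) auto
  show "0 < cox b \<and> coxeter_element b ^\<^sub>m cox b = 1\<^sub>m (num_nodes b)"
    using h per by (simp add: coxeter_element_pow_eq_1_iff[OF ok(1)])
  fix m assume m: "0 < m \<and> coxeter_element b ^\<^sub>m m = 1\<^sub>m (num_nodes b)"
  let ?x = "\<lambda>t i. short_weight b i * marks b i * cos ((2 * real t - \<eta> i) * theta b)"
  have x: "mesh b ?x"
    using ok \<eta>(1) by (intro mesh_cos) (auto simp: marks_eigenvalue_def)
  have n: "0 < num_nodes b" using ok by (cases b) auto
  have "?x m 0 = ?x 0 0"
    using m x n coxeter_element_pow_eq_1_iff[OF ok(1), of m] by blast
  then have "cos (2 * real m * theta b) = 1"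
    using ok n short_weight_pos[of b 0] finite_marks_pos[of b 0] by (simp add: \<eta>(2) marks_def)
  then obtain z :: int where z: "2 * real m * theta b = of_int z * 2 * pi"
    by (auto simp: cos_one_2pi_int)
  then have "real m = of_int z * real (cox b)"
    using h by (simp add: field_simps)
  then have "int m = z * int (cox b)"
    by (metis of_int_eq_iff of_int_mult of_int_of_nat_eq)
  moreover from this have "0 < z"
    using m by (metis of_nat_0_less_iff zero_less_mult_pos2 h)
  ultimately show "cox b \<le> m"
    by (metis mult_le_cancel_right1 of_nat_le_iff int_one_le_iff_zero_less not_less of_nat_less_0_iff)
qed

section \<open>Coxeter numbers\<close>

text \<open>The differences \<open>X t (Suc j) - X t j\<close> are constant along the diagonals of the mesh; their
  values at the last node determine everything.\<close>

lemma mesh_chain: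
  fixes X :: "nat \<Rightarrow> nat \<Rightarrow> real"
  assumes X0: "\<And>t. X t 0 = 0"
    and rel: "\<And>t i. Suc i < n \<Longrightarrow> X (Suc t) (Suc i) + X t (Suc i) = X t i + X (Suc t) (Suc (Suc i))"
    and j: "j \<le> n"
  shows "X t j = (\<Sum>l<j. X (t + (n - 1 - l)) n - X (t + (n - 1 - l)) (n - 1))"
proof -
  have diag: "X t (Suc l) - X t l = X (t + k) (Suc (l + k)) - X (t + k) (l + k)" if "l + k < n" for t l k
    using that
  proof (induction k)
    case (Suc k)
    then show ?case using rel[of "l + k" "t + k"] by simp
  qed simp
  have "X t (Suc l) - X t l = X (t + (n - 1 - l)) n - X (t + (n - 1 - l)) (n - 1)" if "l < j" for l
    using diag[of l "n - 1 - l" t] that j by simp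
  then have "(\<Sum>l<j. X (t + (n - 1 - l)) n - X (t + (n - 1 - l)) (n - 1)) = (\<Sum>l<j. X t (Suc l) - X t l)"
    by (intro sum.cong) auto
  also have "\<dots> = X t j"
    using X0 by (simp add: sum_lessThan_telescope)
  finally show ?thesis by simp
qed

text \<open>The vanishing right end says that any \<open>n\<close> consecutive end differences
  \<open>z\<close> add up to 0. Two such windows shifted by one step show that \<open>z\<close> has
  period \<open>n\<close>.\<close>

lemma mesh_chain_cyclic:
  fixes X :: "nat \<Rightarrow> nat \<Rightarrow> real"
  assumes X0: "\<And>t. X t 0 = 0" and Xn: "\<And>t. X t n = 0"
    and rel: "\<And>t i. Suc i < n \<Longrightarrow> X (Suc t) (Suc i) + X t (Suc i) = X t i + X (Suc t) (Suc (Suc i))"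
    and j: "j \<le> n" and n: "0 < n"
  shows "X (t + n) j = X t j"
proof -
  define z where "z s = X s n - X s (n - 1)" for s
  have X: "X t j = (\<Sum>l<j. z (t + (n - 1 - l)))" if "j \<le> n" for t j
    unfolding z_def using X0 rel that by (rule mesh_chain)
  have zero: "(\<Sum>l<n. z (t + l)) = 0" for t
    using X[of n t] Xn[of t] sum.nat_diff_reindex[of "\<lambda>l. z (t + l)" n] by simp
  have z: "z (t + n) = z t" for t
  proof -
    have "(\<Sum>l<Suc n. z (t + l)) = z t + (\<Sum>l<n. z (Suc t + l))"
      by (subst sum.lessThan_Suc_shift) simp
    then show ?thesis using zero[of t] zero[of "Suc t"] by simp
  qed
  have "X (t + n) j = (\<Sum>l<j. z (t + (n - 1 - l) + n))"
    by (simp only: X[OF j] add_ac)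
  also have "\<dots> = X t j"
    by (simp only: X[OF j] z)
  finally show ?thesis .
qed

text \<open>Comparing the sums for node \<open>n\<close> at time t + 1 and node \<open>n - 1\<close>
  at time t leaves the single term \<open>z (t + n)\<close>; the end relation equates this
  difference with \<open>- z t\<close>.\<close>

lemma mesh_chain_signed_cyclic:
  fixes X :: "nat \<Rightarrow> nat \<Rightarrow> real"
  assumes X0: "\<And>t. X t 0 = 0"
    and rel: "\<And>t i. Suc i < n \<Longrightarrow> X (Suc t) (Suc i) + X t (Suc i) = X t i + X (Suc t) (Suc (Suc i))"
    and end_rel: "\<And>t. X (Suc t) n + X t n = 2 * X t (n - 1)"
    and j: "j \<le> n" and n: "0 < n"
  shows "X (t + n) j = - X t j"
proof -
  define z where "z s = X s n - X s (n - 1)" for s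
  have X: "X t j = (\<Sum>l<j. z (t + (n - 1 - l)))" if "j \<le> n" for t j
    unfolding z_def using X0 rel that by (rule mesh_chain)
  obtain n' where n': "n = Suc n'" using n by (cases n) auto
  have z: "z (t + n) = - z t" for t
  proof -
    have "X (Suc t) n = (\<Sum>l<n. z (Suc t + (n - 1 - l)))" by (rule X) simp
    also have "\<dots> = z (t + n) + (\<Sum>l<n'. z (Suc t + (n - 1 - Suc l)))"
      unfolding n' by (subst sum.lessThan_Suc_shift) simp
    also have "(\<Sum>l<n'. z (Suc t + (n - 1 - Suc l))) = (\<Sum>l<n'. z (t + (n - 1 - l)))"
      by (intro sum.cong) (auto simp: n' Suc_diff_Suc)
    also have "\<dots> = X t n'"
      using X[of n' t] by (simp add: n')
    finally show ?thesis using end_rel[of t] by (simp add: z_def n')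
  qed
  have "X (t + n) j = (\<Sum>l<j. z (t + (n - 1 - l) + n))"
    by (simp only: X[OF j] add_ac)
  also have "\<dots> = - X t j"
    by (simp only: X[OF j] z sum_negf)
  finally show ?thesis .
qed

lemma coxeter_number_A:
  assumes r: "1 \<le> r"
  shows "coxeter_number (A r) = r + 1"
proof -
  have "coxeter_number (A r) = cox (A r)"
  proof (rule coxeter_number_eqI[where \<eta> = real])
    fix x i assume x: "mesh (A r) x" and i: "i < num_nodes (A r)"
    \<comment> \<open>A zero node is added at either end, so that every true node satisfies the same
      relation; the padded chain has length \<open>Suc r\<close>, the Coxeter number.\<close>
    define X where "X t j = (if j = 0 \<or> j = Suc r then 0 else x t (j - 1))" for t j
    have "X (0 + Suc r) (Suc i) = X 0 (Suc i)"
    proof (rule mesh_chain_cyclic)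
      fix t i assume "Suc i < Suc r"
      then show "X (Suc t) (Suc i) + X t (Suc i) = X t i + X (Suc t) (Suc (Suc i))"
        using meshD[OF x, of i t] by (cases i) (auto simp: X_def bond_def)
    qed (use i in \<open>auto simp: X_def\<close>)
    then show "x (cox (A r)) i = x 0 i"
      using i by (simp add: X_def)
  qed (use r in \<open>auto simp: set_chain\<close>)
  then show ?thesis by simp
qed

lemma signed_period_twice:
  fixes y :: "nat \<Rightarrow> real"
  assumes "\<And>t. y (t + n) = - y t"
  shows "y (2 * n) = y 0"
  using assms[of 0] assms[of n] by (simp add: mult_2)

lemma coxeter_number_B:
  assumes r: "2 \<le> r"
  shows "coxeter_number (B r) = 2 * r"
proof -
  have "coxeter_number (B r) = cox (B r)"
  proof (rule coxeter_number_eqI[where \<eta> = real])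
    fix x i assume x: "mesh (B r) x" and i: "i < num_nodes (B r)"
    define X where "X t j = (if j = 0 then 0 else x t (j - 1))" for t j
    obtain s where s: "r = Suc (Suc s)"
      using r le_Suc_ex[of 2 r] by auto
    have "X (t + r) (Suc i) = - X t (Suc i)" for t
    proof (rule mesh_chain_signed_cyclic)
      fix t i assume "Suc i < r"
      then show "X (Suc t) (Suc i) + X t (Suc i) = X t i + X (Suc t) (Suc (Suc i))"
        using meshD[OF x, of i t] by (cases i) (auto simp: X_def bond_def s)
    next
      fix t
      show "X (Suc t) r + X t r = 2 * X t (r - 1)"
        using meshD[OF x, of "Suc s" t] by (simp add: X_def bond_def s)
    qed (use i in \<open>auto simp: X_def\<close>)
    then have "X (2 * r) (Suc i) = X 0 (Suc i)"
      by (rule signed_period_twice)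
    then show "x (cox (B r)) i = x 0 i"
      by (simp add: X_def)
  qed (use r in \<open>auto simp: set_chain\<close>)
  then show ?thesis by simp
qed

lemma coxeter_number_C:
  assumes r: "2 \<le> r"
  shows "coxeter_number (C r) = 2 * r"
proof -
  have "coxeter_number (C r) = cox (C r)"
  proof (rule coxeter_number_eqI[where \<eta> = real])
    fix x i assume x: "mesh (C r) x" and i: "i < num_nodes (C r)"
    \<comment> \<open>In type C the factor 2 of the double bond occurs in the equation of the last
      but one node. Doubling the last value moves it to the end and reproduces the relations of type
      B.\<close>
    define X where "X t j = (if j = 0 then 0 else if j = r then 2 * x t (j - 1) else x t (j - 1))" for t j
    obtain s where s: "r = Suc (Suc s)"
      using r le_Suc_ex[of 2 r] by auto
    have "X (t + r) (Suc i) = - X t (Suc i)" for t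
    proof (rule mesh_chain_signed_cyclic)
      fix t i assume i: "Suc i < r"
      show "X (Suc t) (Suc i) + X t (Suc i) = X t i + X (Suc t) (Suc (Suc i))"
        using meshD[OF x, of i t] i by (cases i) (auto simp: X_def bond_def s)
    next
      fix t
      show "X (Suc t) r + X t r = 2 * X t (r - 1)"
        using meshD[OF x, of "Suc s" t] by (simp add: X_def bond_def s)
    qed (use i in \<open>auto simp: X_def\<close>)
    then have "X (2 * r) (Suc i) = X 0 (Suc i)"
      by (rule signed_period_twice)
    then show "x (cox (C r)) i = x 0 i"
      by (auto simp: X_def split: if_splits)
  qed (use r in \<open>auto simp: set_chain\<close>)
  then show ?thesis by simp
qed

text \<open>The sum of the two spinor nodes continues the chain as in type B, and their difference only
  changes sign.\<close>

lemma coxeter_number_D: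
  assumes r: "4 \<le> r"
  shows "coxeter_number (D r) = 2 * (r - 1)"
proof -
  obtain s where s: "r = s + 4"
    using r le_Suc_ex[of 4 r] by auto
  have "coxeter_number (D r) = cox (D r)"
  \<comment> \<open>Both spinor nodes are attached to node \<open>r - 3\<close>, so they share the
    grade \<open>r - 2\<close>.\<close>
  proof (rule coxeter_number_eqI[where \<eta> = "\<lambda>i. if i = r - 1 then real (r - 2) else real i"])
    fix x i assume x: "mesh (D r) x" and i: "i < num_nodes (D r)"
    define X where "X t j = (if j = 0 then 0 else if j = s + 3 then x t (s + 2) + x t (s + 3)
      else x t (j - 1))" for t j
    have spinor: "x (Suc t) (s + 2) + x t (s + 2) = x t (s + 1)"
      "x (Suc t) (s + 3) + x t (s + 3) = x t (s + 1)" for t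
      using meshD[OF x, of "s + 2" t] meshD[OF x, of "s + 3" t] by (simp_all add: s bond_def)
    have "X (t + (s + 3)) j = - X t j" if "j \<le> s + 3" for t j
    proof (rule mesh_chain_signed_cyclic)
      fix t i assume i: "Suc i < s + 3"
      consider "i < s + 1" | "i = s + 1" using i by linarith
      then show "X (Suc t) (Suc i) + X t (Suc i) = X t i + X (Suc t) (Suc (Suc i))"
      proof cases
        case 1
        then show ?thesis
          using meshD[OF x, of i t] by (cases i) (simp_all add: s X_def bond_def)
      next
        case 2
        then show ?thesis
          using meshD[OF x, of i t] by (simp add: s X_def bond_def eval_nat_numeral)
      qed
    next
      fix t
      show "X (Suc t) (s + 3) + X t (s + 3) = 2 * X t (s + 3 - 1)"
        using spinor[of t] by (simp add: X_def)
    qed (use that in \<open>auto simp: X_def\<close>)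
    then have X: "X (2 * (s + 3)) j = X 0 j" if "j \<le> s + 3" for j
      using that by (intro signed_period_twice) auto
    have "x t (s + 2) - x t (s + 3) = (-1) ^ t * (x 0 (s + 2) - x 0 (s + 3))" for t
    proof (induction t)
      case (Suc t)
      then show ?case using spinor[of t] by simp
    qed simp
    from this[of "2 * (s + 3)"]
    have diff: "x (2 * (s + 3)) (s + 2) - x (2 * (s + 3)) (s + 3) = x 0 (s + 2) - x 0 (s + 3)"
      by simp
    consider "i < s + 2" | "i = s + 2" | "i = s + 3" using i s by force
    then have "x (2 * (s + 3)) i = x 0 i"
    proof cases
      case 1
      then show ?thesis using X[of "Suc i"] by (simp add: X_def)
    qed (use X[of "s + 3"] diff in \<open>simp_all add: X_def\<close>)
    then show "x (cox (D r)) i = x 0 i"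
      by (simp add: s algebra_simps)
  qed (use s in \<open>auto simp: set_chain\<close>)
  then show ?thesis by simp
qed

text \<open>One step of the mesh relation, solved for the new values.\<close>

fun sweep_E6 :: "real list \<Rightarrow> real list" where
  "sweep_E6 [a0, a1, a2, a3, a4, a5] =
     (let c5 = a2 - a5; c4 = a3 - a4; c3 = a2 + c4 - a3; c2 = a1 + c3 + c5 - a2;
          c1 = a0 + c2 - a1; c0 = c1 - a0
      in [c0, c1, c2, c3, c4, c5])"
| "sweep_E6 l = l"

fun sweep_E7 :: "real list \<Rightarrow> real list" where
  "sweep_E7 [a0, a1, a2, a3, a4, a5, a6] =
     (let c6 = a2 - a6; c5 = a4 - a5; c4 = a3 + c5 - a4; c3 = a2 + c4 - a3;
          c2 = a1 + c3 + c6 - a2; c1 = a0 + c2 - a1; c0 = c1 - a0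
      in [c0, c1, c2, c3, c4, c5, c6])"
| "sweep_E7 l = l"

fun sweep_E8 :: "real list \<Rightarrow> real list" where
  "sweep_E8 [a0, a1, a2, a3, a4, a5, a6, a7] =
     (let c7 = a2 - a7; c6 = a5 - a6; c5 = a4 + c6 - a5; c4 = a3 + c5 - a4; c3 = a2 + c4 - a3;
          c2 = a1 + c3 + c7 - a2; c1 = a0 + c2 - a1; c0 = c1 - a0
      in [c0, c1, c2, c3, c4, c5, c6, c7])"
| "sweep_E8 l = l"

fun sweep_F4 :: "real list \<Rightarrow> real list" where
  "sweep_F4 [a0, a1, a2, a3] =
     (let c3 = a2 - a3; c2 = 2 * a1 + c3 - a2; c1 = a0 + c2 - a1; c0 = c1 - a0
      in [c0, c1, c2, c3])"
| "sweep_F4 l = l"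

text \<open>The full period is evaluated here because -1 is not in the Weyl group of type E6. In
  types E7, E8 and F4 it is, and the power h/2 already gives -1.\<close>

lemma sweep_E6_period:
  "(sweep_E6 ^^ 12) [a0, a1, a2, a3, a4, a5] = [a0, a1, a2, a3, a4, a5]"
  by (simp add: Let_def numeral_eq_Suc)

lemma sweep_E7_half_period:
  "(sweep_E7 ^^ 9) [a0, a1, a2, a3, a4, a5, a6] = [- a0, - a1, - a2, - a3, - a4, - a5, - a6]"
  by (simp add: Let_def numeral_eq_Suc)

lemma sweep_E8_half_period:
  "(sweep_E8 ^^ 15) [a0, a1, a2, a3, a4, a5, a6, a7]
     = [- a0, - a1, - a2, - a3, - a4, - a5, - a6, - a7]"
  by (simp add: Let_def numeral_eq_Suc)

lemma sweep_F4_half_period: "(sweep_F4 ^^ 6) [a0, a1, a2, a3] = [- a0, - a1, - a2, - a3]"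
  by (simp add: Let_def numeral_eq_Suc)

lemma funpow_orbit:
  assumes "\<And>t. l (Suc t) = f (l t)"
  shows "l h = (f ^^ h) (l 0)"
  by (induction h) (simp_all add: assms)

lemma coxeter_number_E:
  assumes r: "r \<in> {6, 7, 8}"
  shows "coxeter_number (E r) = cox (E r)"
\<comment> \<open>Node \<open>r - 1\<close> is attached to node 2, hence its grade 3.\<close>
proof (rule coxeter_number_eqI[where \<eta> = "\<lambda>i. if i = r - 1 then 3 else real i"])
  fix x i assume x: "mesh (E r) x" and i: "i < num_nodes (E r)"
  note M = meshD[OF x]
  consider "r = 6" | "r = 7" | "r = 8" using r by auto
  then show "x (cox (E r)) i = x 0 i"
  proof cases
    case 1
    let ?l = "\<lambda>t. [x t 0, x t 1, x t 2, x t 3, x t 4, x t 5]"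
    have "?l (Suc t) = sweep_E6 (?l t)" for t
      using M[of 0 t] M[of 1 t] M[of 2 t] M[of 3 t] M[of 4 t] M[of 5 t]
      by (simp add: 1 bond_def Let_def flip: One_nat_def)
    then have "?l 12 = (sweep_E6 ^^ 12) (?l 0)" by (rule funpow_orbit)
    also have "\<dots> = ?l 0" by (rule sweep_E6_period)
    finally have "?l 12 = ?l 0" .
    moreover have "i \<in> {0, 1, 2, 3, 4, 5}" using i 1 by auto
    ultimately show ?thesis by (elim insertE emptyE; simp add: 1)
  next
    case 2
    let ?l = "\<lambda>t. [x t 0, x t 1, x t 2, x t 3, x t 4, x t 5, x t 6]"
    have "?l (Suc t) = sweep_E7 (?l t)" for t
      using M[of 0 t] M[of 1 t] M[of 2 t] M[of 3 t] M[of 4 t] M[of 5 t] M[of 6 t]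
      by (simp add: 2 bond_def Let_def flip: One_nat_def)
    then have "?l 18 = (sweep_E7 ^^ (9 + 9)) (?l 0)" using funpow_orbit[of ?l sweep_E7 18] by simp
    then have "?l 18 = ?l 0" by (simp only: funpow_add o_apply sweep_E7_half_period minus_minus)
    moreover have "i \<in> {0, 1, 2, 3, 4, 5, 6}" using i 2 by auto
    ultimately show ?thesis by (elim insertE emptyE; simp add: 2)
  next
    case 3
    let ?l = "\<lambda>t. [x t 0, x t 1, x t 2, x t 3, x t 4, x t 5, x t 6, x t 7]"
    have "?l (Suc t) = sweep_E8 (?l t)" for t
      using M[of 0 t] M[of 1 t] M[of 2 t] M[of 3 t] M[of 4 t] M[of 5 t] M[of 6 t] M[of 7 t]
      by (simp add: 3 bond_def Let_def flip: One_nat_def)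
    then have "?l 30 = (sweep_E8 ^^ (15 + 15)) (?l 0)" using funpow_orbit[of ?l sweep_E8 30] by simp
    then have "?l 30 = ?l 0" by (simp only: funpow_add o_apply sweep_E8_half_period minus_minus)
    moreover have "i \<in> {0, 1, 2, 3, 4, 5, 6, 7}" using i 3 by auto
    ultimately show ?thesis by (elim insertE emptyE; simp add: 3)
  qed
qed (use r in \<open>auto simp: set_chain\<close>)

lemma coxeter_number_F4: "coxeter_number F4 = 12"
proof -
  have "coxeter_number F4 = cox F4"
  proof (rule coxeter_number_eqI[where \<eta> = real])
    fix x i assume x: "mesh F4 x" and i: "i < num_nodes F4"
    note M = meshD[OF x]
    let ?l = "\<lambda>t. [x t 0, x t 1, x t 2, x t 3]"
    have "?l (Suc t) = sweep_F4 (?l t)" for t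
      using M[of 0 t] M[of 1 t] M[of 2 t] M[of 3 t]
      by (simp add: bond_def Let_def flip: One_nat_def)
    then have "?l 12 = (sweep_F4 ^^ (6 + 6)) (?l 0)" using funpow_orbit[of ?l sweep_F4 12] by simp
    then have "?l 12 = ?l 0" by (simp only: funpow_add o_apply sweep_F4_half_period minus_minus)
    moreover have "i \<in> {0, 1, 2, 3}" using i by auto
    ultimately show "x (cox F4) i = x 0 i" by (elim insertE emptyE; simp)
  qed (auto simp: set_chain)
  then show ?thesis by simp
qed

lemma coxeter_number_eq:
  assumes "dynkin_ok b" "\<not> affine_type b"
  shows "coxeter_number b = cox b"
  using assms
  by (cases b) (simp_all add: coxeter_number_A coxeter_number_B coxeter_number_C coxeter_number_D
      coxeter_number_E coxeter_number_F4 del: cox.simps(5))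

section \<open>Quivers at large N\<close>

abbreviation gauge_weight :: "gauge \<Rightarrow> real" where
  "gauge_weight h \<equiv> real (gauge_d h)"

lemma gauge_weight_fund: "fund_weight h = gauge_weight h / 2"
  by (cases h) (auto simp: fund_weight_def)

lemma gauge_dim_pos: "gauge_ok h n \<Longrightarrow> 0 < gauge_dim h n"
proof (cases h)
  case SU
  assume "gauge_ok h n"
  then show ?thesis using SU power_mono[of 2 "real n" 2] by simp
qed auto

lemma n_V_pos:
  assumes "conformal T k f" "scft_ok T"
  shows "0 < n_V T k"
proof -
  have "gauge_ok (gauge_at T i) (k i)" if "i < nodes T" for i
    using assms that by (cases T) auto
  moreover have "0 < nodes T"
  proof (cases T)
    case (Quiver b g t t')
    then show ?thesis using assms(2) by (cases b) auto
  qed auto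
  ultimately show ?thesis
    unfolding n_V_def by (intro sum_pos) (auto intro: gauge_dim_pos)
qed

text \<open>This ties the Lagrangian to the Cartan matrix: the weight d_i times the bond is 2 on an
  edge with an su end, which is a full hypermultiplet, and 1 on an so-usp edge, a
  half-hypermultiplet. Off the simply laced case, su nodes are exactly the short ones.\<close>

lemma edge_weight:
  assumes g: "gauge_assignment b g" and ij: "i < num_nodes b" "j < num_nodes b" "adjacent b i j"
  shows "gauge_weight (g i) * bond b i j = 2 * bifund_weight (g i) (g j)"
proof (cases "simply_laced b")
  case True
  then have "g i = SU \<and> g j = SU \<or> g i \<noteq> SU \<and> g j \<noteq> SU"
    using g ij(1,2) by (auto simp: gauge_assignment_def)
  then show ?thesis
    using True by (cases "g i"; cases "g j") (auto simp: simply_laced_def bond_def bifund_weight_def)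
next
  case False
  have short: "u \<in> short_nodes b \<longleftrightarrow> g u = SU" if "u < num_nodes b" for u
  proof -
    have "gauge_d (g u) = (if u \<in> short_nodes b then 2 else 1)"
      using g False that by (simp add: gauge_assignment_def)
    then show ?thesis by (cases "g u") (auto split: if_splits)
  qed
  show ?thesis
    unfolding bond_def bifund_weight_def short[OF ij(1)] short[OF ij(2)]
    by (cases "g i"; cases "g j") simp_all
qed

lemma bifund_weight_commute: "bifund_weight g h = bifund_weight h g"
  by (auto simp: bifund_weight_def)

lemma gauge_weight_adj:
  assumes g: "gauge_assignment b g" and ij: "i < num_nodes b" "j < num_nodes b"
  shows "gauge_weight (g i) * adj b i j = gauge_weight (g j) * adj b j i"
proof (cases "num_edges b i j = 0")
  case True
  then show ?thesis using ij by (auto simp: adj_eq num_edges_def)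
next
  case False
  then have a: "adjacent b i j" "adjacent b j i"
    by (auto simp: adjacent_def num_edges_def)
  have "gauge_weight (g i) * bond b i j = gauge_weight (g j) * bond b j i"
    using edge_weight[OF g ij a(1)] edge_weight[OF g ij(2,1) a(2)] bifund_weight_commute by metis
  then show ?thesis using ij by (simp add: adj_eq num_edges_def add.commute mult.left_commute)
qed

lemma sum_nbr_sum:
  assumes "\<And>u v. (u, v) \<in> set es \<Longrightarrow> u < n \<and> v < n"
  shows "(\<Sum>i<n. h i * nbr_sum es i (G i)) = (\<Sum>(u, v)\<leftarrow>es. h u * G u v + h v * G v u)"
  using assms
proof (induction es)
  case (Cons e es)
  obtain u v where e: "e = (u, v)" by (cases e)
  have uv: "u < n" "v < n" using Cons.prems e by auto
  have eq: "h i * nbr_sum (e # es) i (G i) = (if i = u then h u * G u v else 0)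
      + (if i = v then h v * G v u else 0) + h i * nbr_sum es i (G i)" for i
    by (auto simp: e algebra_simps)
  show ?case unfolding eq sum.distrib using Cons uv by (auto simp: e)
qed simp

text \<open>Each edge is met from both of its ends, and by \<open>edge_weight\<close> each end
  contributes twice the bifundamental weight.\<close>

lemma adj_quadratic_form:
  assumes ok: "dynkin_ok b" and g: "gauge_assignment b g"
  shows "(\<Sum>i<num_nodes b. gauge_weight (g i) * x i * (\<Sum>j<num_nodes b. adj b i j * x j))
    = 4 * (\<Sum>(u, v)\<leftarrow>edges b. bifund_weight (g u) (g v) * x u * x v)"
proof -
  let ?n = "num_nodes b"
  have "(\<Sum>i<?n. gauge_weight (g i) * x i * (\<Sum>j<?n. adj b i j * x j))
      = (\<Sum>i<?n. (gauge_weight (g i) * x i) * nbr_sum (edges b) i (\<lambda>j. bond b i j * x j))"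
    using ok by (simp add: adj_row_sum)
  also have "\<dots> = (\<Sum>(u, v)\<leftarrow>edges b. gauge_weight (g u) * x u * (bond b u v * x v)
      + gauge_weight (g v) * x v * (bond b v u * x u))"
    using edges_range[OF ok] by (intro sum_nbr_sum) auto
  also have "\<dots> = (\<Sum>(u, v)\<leftarrow>edges b. 4 * (bifund_weight (g u) (g v) * x u * x v))"
  proof (intro arg_cong[of _ _ sum_list] map_cong refl, clarify)
    fix u v assume uv: "(u, v) \<in> set (edges b)"
    then have "count_list (edges b) (u, v) \<noteq> 0"
      by (simp add: count_list_0_iff)
    then have a: "adjacent b u v" "adjacent b v u"
      by (auto simp: adjacent_def num_edges_def)
    have e: "gauge_weight (g u) * bond b u v = 2 * bifund_weight (g u) (g v)"
      "gauge_weight (g v) * bond b v u = 2 * bifund_weight (g u) (g v)"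
      using edge_weight[OF g _ _ a(1)] edge_weight[OF g _ _ a(2)] edges_range[OF ok uv]
        bifund_weight_commute by auto
    have "gauge_weight (g u) * x u * (bond b u v * x v) + gauge_weight (g v) * x v * (bond b v u * x u)
        = (gauge_weight (g u) * bond b u v + gauge_weight (g v) * bond b v u) * x u * x v"
      by (simp add: algebra_simps)
    then show "gauge_weight (g u) * x u * (bond b u v * x v) + gauge_weight (g v) * x v * (bond b v u * x u)
        = 4 * (bifund_weight (g u) (g v) * x u * x v)"
      unfolding e by simp
  qed
  also have "\<dots> = 4 * (\<Sum>(u, v)\<leftarrow>edges b. bifund_weight (g u) (g v) * x u * x v)"
    by (simp add: sum_list_const_mult case_prod_unfold)
  finally show ?thesis .
qed

section \<open>Two-index hypermultiplets and folded eigenvectors\<close>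

definition tensor_count :: "dynkin \<Rightarrow> tensor option \<Rightarrow> tensor option \<Rightarrow> nat \<Rightarrow> real" where
  "tensor_count b t t' i = real (length (tensors_at b t t' i))"

text \<open>The two terms are added since on \<open>A 1\<close> the first and the last node coincide
  and may carry both hypermultiplets.\<close>

lemma tensor_count_eq:
  "tensor_count b t t' i = (if i = 0 \<and> t \<noteq> None then 1 else 0)
     + (if i = num_nodes b - 1 \<and> t' \<noteq> None then 1 else 0)"
  by (auto simp: tensor_count_def tensors_at_def)

text \<open>A two-index hypermultiplet acts like a bifundamental of the node with its own mirror image.\<close>

definition folded_adj :: "dynkin \<Rightarrow> tensor option \<Rightarrow> tensor option \<Rightarrow> nat \<Rightarrow> nat \<Rightarrow> real" where
  "folded_adj b t t' i j = adj b i j + (if i = j then tensor_count b t t' i else 0)"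

lemma folded_adj_sum:
  assumes "i < num_nodes b"
  shows "(\<Sum>j<num_nodes b. folded_adj b t t' i j * x j)
    = (\<Sum>j<num_nodes b. adj b i j * x j) + tensor_count b t t' i * x i"
proof -
  have "folded_adj b t t' i j * x j
      = adj b i j * x j + (if j = i then tensor_count b t t' i * x i else 0)" for j
    by (auto simp: folded_adj_def algebra_simps)
  then show ?thesis using assms by (simp add: sum.distrib)
qed

lemma doubled_ok:
  assumes "dynkin_ok b"
  shows "dynkin_ok (doubled b m)"
  using assms by (cases b) auto

text \<open>In types A and D an eigenvector of the doubled diagram that is symmetric under its
  reflection restricts to one half; the edge between a node and its mirror image becomes the
  diagonal term. In type C the constant vector works, and type B is excluded because its node 0 is
  long.\<close>

lemma folded_eigenvector_exists:
  assumes ok: "dynkin_ok b" and tens: "tensors_ok b g t t'" and g: "gauge_assignment b g"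
  shows "\<exists>p. (\<forall>i<num_nodes b. 0 < p i \<and> nbr_sum (edges b) i (\<lambda>j. bond b i j * p j)
      + tensor_count b t t' i * p i = largest_eigenvalue (doubled b (num_tensors t t')) * p i)"
proof (cases "num_tensors t t' = 0")
  case True
  then have "t = None" "t' = None" by (auto simp: num_tensors_def split: if_splits)
  then have tc: "tensor_count b t t' i = 0" for i
    by (simp add: tensor_count_eq)
  have "doubled b (num_tensors t t') = b"
    unfolding True by (cases b) simp_all
  then have lam: "largest_eigenvalue (doubled b (num_tensors t t')) = marks_eigenvalue b"
    using largest_eigenvalue_eq[OF ok] by simp
  interpret positive_eigenvector "num_nodes b" "adj b" "short_weight b" "marks b" "marks_eigenvalue b"
    by (rule positive_eigenvector_marks[OF ok])
  show ?thesis
    unfolding lam tc using p_pos eigen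
    by (intro exI[of _ "marks b"]) (simp add: adj_row_sum[OF ok])
next
  case False
  have lam: "largest_eigenvalue (doubled b (num_tensors t t'))
      = marks_eigenvalue (doubled b (num_tensors t t'))"
    using ok by (intro largest_eigenvalue_eq doubled_ok)
  have nt: "num_tensors t t' = 1 \<or> num_tensors t t' = 2" "t \<noteq> None \<or> t' \<noteq> None"
    using False by (cases t; cases t'; simp add: num_tensors_def)+
  show ?thesis
  proof (cases b)
    case (A r)
    then obtain s where r: "r = Suc s" using ok by (cases r) auto
    show ?thesis
    proof (cases "num_tensors t t' = 2")
      case True
      then have tt: "t \<noteq> None" "t' \<noteq> None" by (auto simp: num_tensors_def split: if_splits)
      have "nbr_sum (edges b) i (\<lambda>j. bond b i j * 1) + tensor_count b t t' i * 1 = 2 * 1"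
        if "i < num_nodes b" for i
        using that by (cases i; cases "i = s") (auto simp: A r tt bond_def tensor_count_eq)
      moreover have "largest_eigenvalue (doubled b (num_tensors t t')) = 2"
        unfolding lam using True by (simp add: A marks_eigenvalue_def)
      ultimately show ?thesis
        by (intro exI[of _ "\<lambda>_. 1"]) simp
    next
      case False
      then have nt1: "num_tensors t t' = 1" using nt by simp
      \<comment> \<open>With \<open>r = Suc s\<close> this is 2 r + 1, the Coxeter number of
        \<open>A (2 * r)\<close>.\<close>
      define h where "h = 2 * s + 3"
      define S where "S m = sin (real m * (pi / real h))" for m
      have lam1: "largest_eigenvalue (doubled b (num_tensors t t')) = 2 * cos (pi / real h)"
        unfolding lam by (simp add: nt1 A r marks_eigenvalue_def h_def algebra_simps)
      have rec: "S m + S (Suc (Suc m)) = 2 * cos (pi / real h) * S (Suc m)" for m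
        using sin_neighbours[of m "pi / real h"] by (simp add: S_def)
      have S0: "S 0 = 0" "S h = 0" by (simp_all add: S_def h_def)
      have S_refl: "S (Suc s) = S (Suc (Suc s))"
      proof -
        have "real (Suc s) * (pi / real h) = pi - real (Suc (Suc s)) * (pi / real h)"
          by (simp add: h_def field_simps)
        then show ?thesis by (simp only: S_def sin_pi_minus)
      qed
      have pos: "0 < m \<Longrightarrow> m < h \<Longrightarrow> 0 < S m" for m
        unfolding S_def by (rule sin_mult_theta_pos)
      have nbr: "nbr_sum (edges b) i (\<lambda>j. bond b i j * G j)
          = (if i < s then G (Suc i) else 0) + (if 0 < i then G (i - 1) else 0)"
        if "i < num_nodes b" for i G
        using that by (auto simp: A r bond_def)
      consider "t \<noteq> None" "t' = None" | "t = None" "t' \<noteq> None"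
        using nt1 by (auto simp: num_tensors_def split: if_splits)
      then show ?thesis
      proof cases
        case 1
        \<comment> \<open>The hypermultiplet sits at node 0, so node 0 is next to the mirror: the
          vector is the second half of the sine vector of \<open>A (2 * r)\<close>, read outwards
          from the middle.\<close>
        define U where "U j = S (Suc (Suc (s + j)))" for j
        have "0 < U i \<and> nbr_sum (edges b) i (\<lambda>j. bond b i j * U j)
            + tensor_count b t t' i * U i = 2 * cos (pi / real h) * U i"
          if i: "i < num_nodes b" for i
        proof
          have "i \<le> s" using i by (simp add: A r)
          then show "0 < U i" unfolding U_def by (intro pos) (auto simp: h_def)
          have "S (Suc (Suc (Suc (s + s)))) = 0"
            using S0(2) by (simp add: h_def mult_2 eval_nat_numeral)
          then have "(if i < s then U (Suc i) else 0) = S (Suc (Suc (Suc (s + i))))"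
            using \<open>i \<le> s\<close> by (auto simp: U_def)
          moreover have "(if 0 < i then U (i - 1) else 0) + (if i = 0 then 1 else 0) * U i = S (Suc (s + i))"
            using S_refl by (cases i) (auto simp: U_def)
          moreover have "tensor_count b t t' i = (if i = 0 then 1 else 0)"
            using 1 by (simp add: tensor_count_eq)
          ultimately show "nbr_sum (edges b) i (\<lambda>j. bond b i j * U j)
              + tensor_count b t t' i * U i = 2 * cos (pi / real h) * U i"
            unfolding nbr[OF i] using rec[of "Suc (s + i)"] by (simp add: U_def[of i])
        qed
        then show ?thesis unfolding lam1 by (intro exI[of _ U]) blast
      next
        case 2
        have "0 < S (Suc i) \<and> nbr_sum (edges b) i (\<lambda>j. bond b i j * S (Suc j))
            + tensor_count b t t' i * S (Suc i) = 2 * cos (pi / real h) * S (Suc i)"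
          if i: "i < num_nodes b" for i
        proof
          have "i \<le> s" using i by (simp add: A r)
          then show "0 < S (Suc i)" by (intro pos) (auto simp: h_def)
          have "(if 0 < i then S (Suc (i - 1)) else 0) = S i"
            using S0(1) by auto
          moreover have "(if i < s then S (Suc (Suc i)) else 0) + (if i = s then 1 else 0) * S (Suc i)
              = S (Suc (Suc i))"
            using S_refl \<open>i \<le> s\<close> by auto
          moreover have tc: "tensor_count b t t' i = (if i = s then 1 else 0)"
            using 2 by (simp add: tensor_count_eq A r)
          ultimately show "nbr_sum (edges b) i (\<lambda>j. bond b i j * S (Suc j))
              + tensor_count b t t' i * S (Suc i) = 2 * cos (pi / real h) * S (Suc i)"
            unfolding nbr[OF i] tc using rec[of i] by linarith
        qed
        then show ?thesis unfolding lam1 by (intro exI[of _ "\<lambda>j. S (Suc j)"]) blast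
      qed
    qed
  next
    case (B r)
    have "\<forall>i<r. gauge_d (g i) = (if i = r - 1 then 2 else 1)"
      using g B by (auto simp: gauge_assignment_def simply_laced_def)
    moreover have "0 < r" "0 \<noteq> r - 1" using ok B by auto
    ultimately have "gauge_d (g 0) = 1" by simp
    moreover have "g 0 = SU" using tens nt(2) B by auto
    ultimately show ?thesis by simp
  next
    case (C r)
    then obtain s where r: "r = Suc (Suc s)"
      using ok le_Suc_ex[of 2 r] by auto
    have tt: "t' = None" "t \<noteq> None" using tens nt C by auto
    have "nbr_sum (edges b) i (\<lambda>j. bond b i j * 1) + tensor_count b t t' i * 1 = 2 * 1"
      if i: "i < num_nodes b" for i
    proof -
      consider "i = 0" | "0 < i" "i < Suc s" | "i = Suc s" using i C r by fastforce
      then show ?thesis by cases (simp_all add: C r tt bond_def tensor_count_eq)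
    qed
    moreover have "largest_eigenvalue (doubled b (num_tensors t t')) = 2"
      unfolding lam using False by (simp add: C marks_eigenvalue_def)
    ultimately show ?thesis
      by (intro exI[of _ "\<lambda>_. 1"]) simp
  next
    case (D r)
    then obtain s where r: "r = s + 4"
      using ok le_Suc_ex[of 4 r] by (auto simp: add.commute)
    have tt: "t' = None" "t \<noteq> None" using tens nt D by auto
    \<comment> \<open>One half of the affine marks of the doubled diagram: 1 at the two spinor nodes
      and 2 elsewhere.\<close>
    define p :: "nat \<Rightarrow> real" where "p i = (if s + 2 \<le> i then 1 else 2)" for i
    have p: "p j = 2" if "j \<le> s + 1" for j
      using that by (simp add: p_def)
    have p': "p (s + 2) = 1" "p (s + 3) = 1" "p (3 + s) = 1" "p (Suc (Suc s)) = 1"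
      by (simp_all add: p_def)
    have bond: "bond (D (s + 4)) i j = 1" for i j
      by (simp add: bond_def)
    have tc: "tensor_count (D (s + 4)) t t' i = (if i = 0 then 1 else 0)" for i
      using tt by (simp add: tensor_count_eq)
    have eig: "nbr_sum (edges b) i (\<lambda>j. bond b i j * p j) + tensor_count b t t' i * p i = 2 * p i"
      if i: "i < num_nodes b" for i
    proof -
      consider "i = 0" | "0 < i" "i < s + 1" | "i = s + 1" | "i = s + 2" | "i = s + 3"
        using i D r by force
      then show ?thesis unfolding D r
        by cases (simp_all add: tc bond p p')
    qed
    have pos: "0 < p i" for i
      by (simp add: p_def)
    have "largest_eigenvalue (doubled b (num_tensors t t')) = 2"
      unfolding lam using False by (simp add: D marks_eigenvalue_def)
    then show ?thesis
      using eig pos by (intro exI[of _ p]) simp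
  qed (use tens nt(2) in \<open>simp_all only: tensors_ok.simps dynkin.case simp_thms\<close>)
qed

lemma folded_positive_eigenvector:
  assumes "scft_ok (Quiver b g t t')"
  obtains p where "positive_eigenvector (num_nodes b) (folded_adj b t t')
    (\<lambda>i. gauge_weight (g i)) p (lambda_max (Quiver b g t t'))"
proof -
  have ok: "dynkin_ok b" "gauge_assignment b g" "tensors_ok b g t t'" using assms by auto
  obtain p where p: "\<forall>i<num_nodes b. 0 < p i \<and> nbr_sum (edges b) i (\<lambda>j. bond b i j * p j)
      + tensor_count b t t' i * p i = largest_eigenvalue (doubled b (num_tensors t t')) * p i"
    using folded_eigenvector_exists[OF ok(1,3,2)] by (elim exE)
  have "positive_eigenvector (num_nodes b) (folded_adj b t t')
    (\<lambda>i. gauge_weight (g i)) p (lambda_max (Quiver b g t t'))"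
  proof
    fix i assume i: "i < num_nodes b"
    show "0 < gauge_weight (g i)" by (cases "g i") auto
    show "0 < p i" using p i by simp
    show "(\<Sum>j<num_nodes b. folded_adj b t t' i j * p j) = lambda_max (Quiver b g t t') * p i"
      using p i by (simp add: folded_adj_sum[OF i] adj_row_sum[OF ok(1) i])
    fix j assume j: "j < num_nodes b"
    show "0 \<le> folded_adj b t t' i j"
      using adj_nonneg[OF i j] by (simp add: folded_adj_def tensor_count_def)
    show "gauge_weight (g i) * folded_adj b t t' i j = gauge_weight (g j) * folded_adj b t t' j i"
      by (cases "i = j") (simp_all add: folded_adj_def gauge_weight_adj[OF ok(2) i j])
  qed
  then show thesis by (rule that)
qed

section \<open>Leading order of the rates along a large-N family\<close>

lemma tendsto_sum_list:
  fixes F :: "'a \<Rightarrow> 'b \<Rightarrow> real"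
  assumes "\<And>x. x \<in> set xs \<Longrightarrow> (F x \<longlongrightarrow> G x) net"
  shows "((\<lambda>m. \<Sum>x\<leftarrow>xs. F x m) \<longlongrightarrow> (\<Sum>x\<leftarrow>xs. G x)) net"
  using assms by (induction xs) (auto intro!: tendsto_add)

lemma sum_list_divide: "(\<Sum>x\<leftarrow>xs. F x) / c = (\<Sum>x\<leftarrow>xs. F x / c)" for c :: real
  by (induction xs) (auto simp: add_divide_distrib)

lemma rate_min_eq:
  assumes "0 < n_V T k"
  shows "rate_min T k f = sqrt ((2 + n_H T k f / n_V T k) / 6)"
  using assms by (simp add: rate_min_def central_charge_def add_divide_distrib)

lemma rate_eq:
  assumes "0 < n_V T k"
  shows "rate T k f i = rate_min T k f * sqrt (n_V T k / gauge_dim (gauge_at T i) (k i))"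
  using assms by (simp add: rate_def rate_min_def flip: real_sqrt_mult)

lemma rate_min_N4SYM:
  assumes "gauge_ok h (k 0)"
  shows "rate_min (N4SYM h) k f = 1 / sqrt 2"
proof -
  have n: "n_V (N4SYM h) k = gauge_dim h (k 0)" by (simp add: n_V_def)
  have "(2 + n_H (N4SYM h) k f / n_V (N4SYM h) k) / 6 = 1 / 2"
    using gauge_dim_pos[OF assms] by (simp add: n)
  then show ?thesis
    using gauge_dim_pos[OF assms] by (subst rate_min_eq) (simp_all add: n real_sqrt_divide)
qed

text \<open>The conformality conditions hold exactly for each member. After division by N or N^2 the
  terms linear in k in the dimensions, the shifts by 2 in the tensor indices and the terms 4 S^i
  disappear, and only \<open>X\<close> is left.\<close>

locale large_N_quiver =
  fixes b :: dynkin and g :: "nat \<Rightarrow> gauge" and t t' :: "tensor option"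
    and k f :: "nat \<Rightarrow> nat \<Rightarrow> nat" and N :: "nat \<Rightarrow> real" and X :: "nat \<Rightarrow> real"
  assumes ok: "scft_ok (Quiver b g t t')"
    and conf: "\<And>m. conformal (Quiver b g t t') (k m) (f m)"
    and N: "filterlim N at_top sequentially"
    and X_pos: "\<And>i. i < num_nodes b \<Longrightarrow> 0 < X i"
    and lim: "\<And>i. i < num_nodes b \<Longrightarrow> (\<lambda>m. real (k m i) / N m) \<longlonglongrightarrow> X i"
begin

abbreviation "n \<equiv> num_nodes b"
abbreviation "\<tau> \<equiv> tensor_count b t t'"
abbreviation "a \<equiv> folded_adj b t t'"

lemma dynkin: "dynkin_ok b" and gauge: "gauge_assignment b g" and tensors: "tensors_ok b g t t'"
  using ok by auto

lemma n_pos: "0 < n"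
  using dynkin by (cases b) auto

lemma const_over_N: "(\<lambda>m. c / N m) \<longlonglongrightarrow> 0"
  using N by (rule real_tendsto_divide_at_top[OF tendsto_const])

lemma N_pos: "\<forall>\<^sub>F m in sequentially. 0 < N m"
  using N by (simp add: filterlim_at_top_dense)

lemma square_lim:
  assumes "i < n"
  shows "(\<lambda>m. (real (k m i))\<^sup>2 / (N m)\<^sup>2) \<longlonglongrightarrow> (X i)\<^sup>2"
  using tendsto_power[OF lim[OF assms], of 2] by (simp add: power_divide)

lemma linear_lim:
  assumes "i < n"
  shows "(\<lambda>m. real (k m i) / (N m)\<^sup>2) \<longlonglongrightarrow> 0"
  using tendsto_mult[OF lim[OF assms] const_over_N[of 1]] by (simp add: power2_eq_square)

lemma const_lim: "(\<lambda>m. c / (N m)\<^sup>2) \<longlonglongrightarrow> 0"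
  using tendsto_mult[OF const_over_N[of c] const_over_N[of 1]] by (simp add: power2_eq_square)

lemma gauge_dim_lim:
  assumes "i < n"
  shows "(\<lambda>m. gauge_dim (g i) (k m i) / (N m)\<^sup>2) \<longlonglongrightarrow> gauge_weight (g i) / 2 * (X i)\<^sup>2"
proof (cases "g i")
  case SU
  then show ?thesis
    using tendsto_diff[OF square_lim[OF assms] const_lim[of 1]] by (simp add: diff_divide_distrib)
next
  case SO
  have eq: "gauge_dim (g i) (k m i) / (N m)\<^sup>2
      = (1 / 2) * ((real (k m i))\<^sup>2 / (N m)\<^sup>2 - real (k m i) / (N m)\<^sup>2)" for m
    by (simp add: SO power2_eq_square diff_divide_distrib right_diff_distrib)
  have "(\<lambda>m. (1 / 2) * ((real (k m i))\<^sup>2 / (N m)\<^sup>2 - real (k m i) / (N m)\<^sup>2))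
      \<longlonglongrightarrow> (1 / 2) * ((X i)\<^sup>2 - 0)"
    by (intro tendsto_intros square_lim linear_lim assms)
  then show ?thesis unfolding eq by (simp add: SO)
next
  case USP
  have eq: "gauge_dim (g i) (k m i) / (N m)\<^sup>2
      = (1 / 2) * ((real (k m i))\<^sup>2 / (N m)\<^sup>2 + real (k m i) / (N m)\<^sup>2)" for m
    by (simp add: USP power2_eq_square add_divide_distrib distrib_left)
  have "(\<lambda>m. (1 / 2) * ((real (k m i))\<^sup>2 / (N m)\<^sup>2 + real (k m i) / (N m)\<^sup>2))
      \<longlonglongrightarrow> (1 / 2) * ((X i)\<^sup>2 + 0)"
    by (intro tendsto_intros square_lim linear_lim assms)
  then show ?thesis unfolding eq by (simp add: USP)
qed

lemma tensor_dim_lim: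
  assumes "i < n"
  shows "(\<lambda>m. tensor_dim x (k m i) / (N m)\<^sup>2) \<longlonglongrightarrow> (X i)\<^sup>2 / 2"
proof (cases x)
  case Sym2
  have eq: "tensor_dim x (k m i) / (N m)\<^sup>2
      = (1 / 2) * ((real (k m i))\<^sup>2 / (N m)\<^sup>2 + real (k m i) / (N m)\<^sup>2)" for m
    by (simp add: Sym2 power2_eq_square add_divide_distrib distrib_left)
  have "(\<lambda>m. (1 / 2) * ((real (k m i))\<^sup>2 / (N m)\<^sup>2 + real (k m i) / (N m)\<^sup>2))
      \<longlonglongrightarrow> (1 / 2) * ((X i)\<^sup>2 + 0)"
    by (intro tendsto_intros square_lim linear_lim assms)
  then show ?thesis unfolding eq by simp
next
  case Alt2
  have eq: "tensor_dim x (k m i) / (N m)\<^sup>2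
      = (1 / 2) * ((real (k m i))\<^sup>2 / (N m)\<^sup>2 - real (k m i) / (N m)\<^sup>2)" for m
    by (simp add: Alt2 power2_eq_square diff_divide_distrib right_diff_distrib)
  have "(\<lambda>m. (1 / 2) * ((real (k m i))\<^sup>2 / (N m)\<^sup>2 - real (k m i) / (N m)\<^sup>2))
      \<longlonglongrightarrow> (1 / 2) * ((X i)\<^sup>2 - 0)"
    by (intro tendsto_intros square_lim linear_lim assms)
  then show ?thesis unfolding eq by simp
qed

lemma tensor_index_lim:
  assumes "i < n"
  shows "(\<lambda>m. real_of_int (tensor_index x (k m i)) / N m) \<longlonglongrightarrow> X i"
  using tendsto_add[OF lim[OF assms] const_over_N[of 2]] tendsto_diff[OF lim[OF assms] const_over_N[of 2]]
  by (cases x) (simp_all add: add_divide_distrib diff_divide_distrib)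

text \<open>The limit of the flavour ranks f^i / N, as given by the leading order of the
  conformality conditions.\<close>

definition F :: "nat \<Rightarrow> real" where
  "F i = 2 * X i - (\<Sum>j<n. a i j * X j)"

lemma flavour_lim:
  assumes i: "i < n"
  shows "(\<lambda>m. real (f m i) / N m) \<longlonglongrightarrow> F i"
proof -
  have "real (f m i) = (\<Sum>j<n. ((if i = j then 2 else 0) - adj b i j) * real (k m j))
      - (\<Sum>x\<leftarrow>tensors_at b t t' i. real_of_int (tensor_index x (k m i))) + 4 * real_of_int (gauge_S (g i))" for m
  proof -
    have "int (f m i) = (\<Sum>j<n. cartan b $$ (i, j) * int (k m j))
        - (\<Sum>x\<leftarrow>tensors_at b t t' i. tensor_index x (k m i)) + 4 * gauge_S (g i)"
      using conf[of m] i by auto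
    then have "real_of_int (int (f m i)) = real_of_int ((\<Sum>j<n. cartan b $$ (i, j) * int (k m j))
        - (\<Sum>x\<leftarrow>tensors_at b t t' i. tensor_index x (k m i)) + 4 * gauge_S (g i))"
      by (rule arg_cong)
    moreover have "real_of_int (\<Sum>j<n. cartan b $$ (i, j) * int (k m j))
        = (\<Sum>j<n. ((if i = j then 2 else 0) - adj b i j) * real (k m j))"
      using i by (simp add: cartan_adj)
    moreover have "real_of_int (\<Sum>x\<leftarrow>xs. tensor_index x q) = (\<Sum>x\<leftarrow>xs. real_of_int (tensor_index x q))" for xs q
      by (induction xs) auto
    ultimately show ?thesis by simp
  qed
  then have "real (f m i) / N m = (\<Sum>j<n. ((if i = j then 2 else 0) - adj b i j) * (real (k m j) / N m))
      - (\<Sum>x\<leftarrow>tensors_at b t t' i. real_of_int (tensor_index x (k m i)) / N m)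
      + 4 * real_of_int (gauge_S (g i)) / N m" for m
    by (simp add: add_divide_distrib diff_divide_distrib sum_divide_distrib sum_list_divide)
  moreover have "(\<lambda>m. (\<Sum>j<n. ((if i = j then 2 else 0) - adj b i j) * (real (k m j) / N m))
      - (\<Sum>x\<leftarrow>tensors_at b t t' i. real_of_int (tensor_index x (k m i)) / N m)
      + 4 * real_of_int (gauge_S (g i)) / N m)
    \<longlonglongrightarrow> (\<Sum>j<n. ((if i = j then 2 else 0) - adj b i j) * X j)
      - (\<Sum>x\<leftarrow>tensors_at b t t' i. X i) + 0"
    using lim by (intro tendsto_intros tendsto_sum_list tensor_index_lim i const_over_N) auto
  moreover have "(\<Sum>j<n. ((if i = j then 2 else 0) - adj b i j) * X j)
      - (\<Sum>x\<leftarrow>tensors_at b t t' i. X i) + 0 = F i"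
  proof -
    have "(\<Sum>j<n. ((if i = j then 2 else 0) - adj b i j) * X j)
        = (\<Sum>j<n. (if j = i then 2 * X i else 0) - adj b i j * X j)"
      by (intro sum.cong) (auto simp: algebra_simps)
    also have "\<dots> = 2 * X i - (\<Sum>j<n. adj b i j * X j)"
      using i by (simp add: sum_subtractf)
    finally show ?thesis
      by (simp add: F_def folded_adj_sum[OF i] tensor_count_def sum_list_triv)
  qed
  ultimately show ?thesis by simp
qed

lemma F_nonneg:
  assumes "i < n"
  shows "0 \<le> F i"
proof (rule tendsto_lowerbound[OF flavour_lim[OF assms]])
  show "\<forall>\<^sub>F m in sequentially. 0 \<le> real (f m i) / N m"
    using N_pos by eventually_elim simp
qed simp

definition V :: real where
  "V = (\<Sum>i<n. gauge_weight (g i) / 2 * (X i)\<^sup>2)"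

definition Q :: real where
  "Q = (\<Sum>i<n. gauge_weight (g i) * X i * (\<Sum>j<n. a i j * X j))"

lemma V_pos: "0 < V"
proof -
  have "0 < gauge_weight (g i)" for i by (cases "g i") auto
  then show ?thesis
    unfolding V_def using n_pos X_pos by (intro sum_pos) (auto simp: less_imp_neq[symmetric])
qed

lemma n_V_lim: "(\<lambda>m. n_V (Quiver b g t t') (k m) / (N m)\<^sup>2) \<longlonglongrightarrow> V"
  unfolding n_V_def V_def sum_divide_distrib nodes.simps gauge_at.simps
  by (intro tendsto_sum gauge_dim_lim) simp

text \<open>Two-index matter sits on su nodes only, where the weight is 2; at all other nodes both
  sides vanish.\<close>

lemma tensor_weight: "i < n \<Longrightarrow> gauge_weight (g i) * \<tau> i = 2 * \<tau> i"
  using tensors by (auto simp: tensor_count_eq)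

text \<open>The fundamentals contribute 2 V - Q/2 because conformality expresses their number
  through the ranks. Bifundamentals and two-index matter together contribute Q/4.\<close>

lemma n_H_lim: "(\<lambda>m. n_H (Quiver b g t t') (k m) (f m) / (N m)\<^sup>2) \<longlonglongrightarrow> 2 * V - Q / 4"
proof -
  define bif where "bif = (\<Sum>(u, v)\<leftarrow>edges b. bifund_weight (g u) (g v) * X u * X v)"
  have "n_H (Quiver b g t t') (k m) (f m) / (N m)\<^sup>2 =
      (\<Sum>(u, v)\<leftarrow>edges b. bifund_weight (g u) (g v) * (real (k m u) / N m) * (real (k m v) / N m))
      + (\<Sum>i<n. fund_weight (g i) * (real (f m i) / N m) * (real (k m i) / N m))
      + (\<Sum>i<n. \<Sum>x\<leftarrow>tensors_at b t t' i. tensor_dim x (k m i) / (N m)\<^sup>2)" for m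
    by (simp add: add_divide_distrib sum_divide_distrib sum_list_divide case_prod_unfold
        power2_eq_square)
  moreover have "(\<lambda>m. (\<Sum>(u, v)\<leftarrow>edges b. bifund_weight (g u) (g v) * (real (k m u) / N m) * (real (k m v) / N m))
      + (\<Sum>i<n. fund_weight (g i) * (real (f m i) / N m) * (real (k m i) / N m))
      + (\<Sum>i<n. \<Sum>x\<leftarrow>tensors_at b t t' i. tensor_dim x (k m i) / (N m)\<^sup>2))
    \<longlonglongrightarrow> bif + (\<Sum>i<n. fund_weight (g i) * F i * X i)
      + (\<Sum>i<n. \<Sum>x\<leftarrow>tensors_at b t t' i. (X i)\<^sup>2 / 2)"
  proof (intro tendsto_add)
    show "(\<lambda>m. \<Sum>(u, v)\<leftarrow>edges b. bifund_weight (g u) (g v) * (real (k m u) / N m) * (real (k m v) / N m))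
        \<longlonglongrightarrow> bif"
      unfolding bif_def case_prod_unfold
      using edges_range[OF dynkin] by (intro tendsto_sum_list tendsto_intros lim) auto
    show "(\<lambda>m. \<Sum>i<n. fund_weight (g i) * (real (f m i) / N m) * (real (k m i) / N m))
        \<longlonglongrightarrow> (\<Sum>i<n. fund_weight (g i) * F i * X i)"
      by (intro tendsto_intros flavour_lim lim) auto
    show "(\<lambda>m. \<Sum>i<n. \<Sum>x\<leftarrow>tensors_at b t t' i. tensor_dim x (k m i) / (N m)\<^sup>2)
        \<longlonglongrightarrow> (\<Sum>i<n. \<Sum>x\<leftarrow>tensors_at b t t' i. (X i)\<^sup>2 / 2)"
      by (intro tendsto_sum tendsto_sum_list tensor_dim_lim) auto
  qed
  moreover have "bif + (\<Sum>i<n. fund_weight (g i) * F i * X i)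
      + (\<Sum>i<n. \<Sum>x\<leftarrow>tensors_at b t t' i. (X i)\<^sup>2 / 2) = 2 * V - Q / 4"
  proof -
    have "(\<Sum>i<n. fund_weight (g i) * F i * X i)
        = (\<Sum>i<n. 2 * (gauge_weight (g i) / 2 * (X i)\<^sup>2)
            - gauge_weight (g i) * X i * (\<Sum>j<n. a i j * X j) / 2)"
      by (intro sum.cong) (auto simp: gauge_weight_fund F_def power2_eq_square algebra_simps diff_divide_distrib)
    also have "\<dots> = 2 * V - Q / 2"
      by (simp add: sum_subtractf V_def Q_def sum_divide_distrib sum_distrib_left)
    finally have fund: "(\<Sum>i<n. fund_weight (g i) * F i * X i) = 2 * V - Q / 2" .
    define tens where "tens = (\<Sum>i<n. \<tau> i * (X i)\<^sup>2)"
    have "Q = (\<Sum>i<n. gauge_weight (g i) * X i * (\<Sum>j<n. adj b i j * X j) + 2 * \<tau> i * (X i)\<^sup>2)"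
      unfolding Q_def
    proof (intro sum.cong refl)
      fix i assume "i \<in> {..<n}"
      then have i: "i < n" by simp
      have "gauge_weight (g i) * X i * (\<Sum>j<n. a i j * X j)
          = gauge_weight (g i) * X i * (\<Sum>j<n. adj b i j * X j) + (gauge_weight (g i) * \<tau> i) * (X i)\<^sup>2"
        unfolding folded_adj_sum[OF i] by (simp add: power2_eq_square algebra_simps)
      then show "gauge_weight (g i) * X i * (\<Sum>j<n. a i j * X j)
          = gauge_weight (g i) * X i * (\<Sum>j<n. adj b i j * X j) + 2 * \<tau> i * (X i)\<^sup>2"
        unfolding tensor_weight[OF i] .
    qed
    also have "\<dots> = 4 * bif + 2 * tens"
      unfolding sum.distrib adj_quadratic_form[OF dynkin gauge] bif_def tens_def
      by (simp add: sum_distrib_left mult.assoc)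
    finally have "Q = 4 * bif + 2 * tens" .
    moreover have "(\<Sum>i<n. \<Sum>x\<leftarrow>tensors_at b t t' i. (X i)\<^sup>2 / 2) = tens / 2"
      unfolding sum_list_triv tens_def tensor_count_def sum_divide_distrib by simp
    ultimately show ?thesis unfolding fund by linarith
  qed
  ultimately show ?thesis by simp
qed

lemma rate_min_lim:
  "(\<lambda>m. rate_min (Quiver b g t t') (k m) (f m)) \<longlonglongrightarrow> sqrt (2 / 3 - Q / (24 * V))"
proof (rule Lim_transform_eventually)
  let ?V = "\<lambda>m. n_V (Quiver b g t t') (k m)" and ?H = "\<lambda>m. n_H (Quiver b g t t') (k m) (f m)"
  have "(2 + (2 * V - Q / 4) / V) / 6 = 2 / 3 - Q / (24 * V)"
    using V_pos by (simp add: field_simps)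
  moreover have "(\<lambda>m. sqrt ((2 + (?H m / (N m)\<^sup>2) / (?V m / (N m)\<^sup>2)) / 6))
      \<longlonglongrightarrow> sqrt ((2 + (2 * V - Q / 4) / V) / 6)"
    using V_pos by (intro tendsto_intros n_H_lim n_V_lim) auto
  ultimately show "(\<lambda>m. sqrt ((2 + (?H m / (N m)\<^sup>2) / (?V m / (N m)\<^sup>2)) / 6))
      \<longlonglongrightarrow> sqrt (2 / 3 - Q / (24 * V))"
    by (simp only:)
  show "\<forall>\<^sub>F m in sequentially. sqrt ((2 + (?H m / (N m)\<^sup>2) / (?V m / (N m)\<^sup>2)) / 6)
      = rate_min (Quiver b g t t') (k m) (f m)"
    using N_pos
  proof eventually_elim
    case (elim m)
    then show ?case using n_V_pos[OF conf ok, of m] by (simp add: rate_min_eq)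
  qed
qed

lemma Q_le: "Q \<le> 2 * lambda_max (Quiver b g t t') * V"
proof -
  obtain p where "positive_eigenvector n a (\<lambda>i. gauge_weight (g i)) p (lambda_max (Quiver b g t t'))"
    by (rule folded_positive_eigenvector[OF ok])
  from positive_eigenvector.rayleigh[OF this, of X] show ?thesis
    by (simp add: Q_def V_def sum_divide_distrib[symmetric])
qed

text \<open>Flavour ranks cannot be negative, so \<open>X\<close> satisfies M X \<le> 2 X; at
  eigenvalue 2 this leaves only equality. An affine quiver thus has no flavour at leading order,
  whatever ranks it starts from.\<close>

lemma Q_eq:
  assumes "lambda_max (Quiver b g t t') = 2"
  shows "Q = 4 * V"
proof -
  obtain p where p: "positive_eigenvector n a (\<lambda>i. gauge_weight (g i)) p (lambda_max (Quiver b g t t'))"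
    by (rule folded_positive_eigenvector[OF ok])
  have "(\<Sum>j<n. a i j * X j) = 2 * X i" if "i < n" for i
    using F_nonneg that
    by (intro positive_eigenvector.superharmonic_eq[OF p assms]) (auto simp: F_def)
  then show ?thesis
    by (simp add: Q_def V_def sum_distrib_left power2_eq_square mult_ac)
qed

end

section \<open>Affine and finite theories, and the bounds on the limiting rate\<close>

lemma largest_eigenvalue_cases:
  assumes "dynkin_ok b"
  shows "if affine_type b then largest_eigenvalue b = 2
    else largest_eigenvalue b = 2 * cos (pi / real (coxeter_number b)) \<and> largest_eigenvalue b < 2"
  using assms largest_eigenvalue_finite_less[OF assms]
  by (auto simp: largest_eigenvalue_eq marks_eigenvalue_def coxeter_number_eq)

lemma lambda_max_affine: "scft_ok T \<Longrightarrow> affine_scft T \<Longrightarrow> lambda_max T = 2"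
  by (cases T) (simp_all add: largest_eigenvalue_eq doubled_ok marks_eigenvalue_def)

lemma lambda_max_finite: "scft_ok T \<Longrightarrow> \<not> affine_scft T \<Longrightarrow> lambda_max T < 2"
  by (cases T) (simp_all add: largest_eigenvalue_finite_less doubled_ok)

lemma sqrt_half: "sqrt (1 / 2) = 1 / sqrt 2"
  by (simp add: real_sqrt_divide)

text \<open>The eight half-hypermultiplets raise the hypermultiplet count from k (k - 1) / 2 to k (k
  + 7) / 2, so n_H / n_V is 1 + 6 / (k + 1). The value 1 / sqrt 2 is reached in the limit only,
  unlike for \<open>N4SYM\<close>.\<close>

lemma USpAlt_rate_min_lim:
  assumes "\<And>m. conformal USpAlt (k m) (f m)" "filterlim (\<lambda>m. real (k m 0)) at_top sequentially"
  shows "(\<lambda>m. rate_min USpAlt (k m) (f m)) \<longlonglongrightarrow> 1 / sqrt 2"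
proof -
  let ?q = "\<lambda>m. real (k m 0)"
  have eq: "rate_min USpAlt (k m) (f m) = sqrt ((2 + (1 + 6 / (1 + ?q m))) / 6)" for m
  proof -
    have k: "k m 0 \<ge> 2" "f m 0 = 8" using assms(1)[of m] by auto
    have V: "n_V USpAlt (k m) = ?q m * (?q m + 1) / 2" by (simp add: n_V_def)
    moreover have "0 < n_V USpAlt (k m)" unfolding V using k by simp
    moreover have "n_H USpAlt (k m) (f m) = ?q m * (?q m + 7) / 2"
      using k by (simp add: fund_weight_def field_simps)
    moreover have "(?q m * (?q m + 7) / 2) / (?q m * (?q m + 1) / 2) = 1 + 6 / (1 + ?q m)"
    proof -
      have "(?q m * (?q m + 7) / 2) / (?q m * (?q m + 1) / 2) = (?q m + 7) / (?q m + 1)"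
        using k by simp
      also have "\<dots> = 1 + 6 / (1 + ?q m)"
        by (simp add: field_simps)
      finally show ?thesis .
    qed
    ultimately show ?thesis by (simp only: rate_min_eq)
  qed
  have "(\<lambda>m. 6 / (1 + ?q m)) \<longlonglongrightarrow> 0"
    by (intro real_tendsto_divide_at_top[OF tendsto_const] filterlim_tendsto_add_at_top[OF tendsto_const] assms(2))
  then have "(\<lambda>m. sqrt ((2 + (1 + 6 / (1 + ?q m))) / 6)) \<longlonglongrightarrow> sqrt ((2 + (1 + 0)) / 6)"
    by (intro tendsto_intros) auto
  then show ?thesis unfolding eq by (simp add: sqrt_half)
qed

lemma rate_min_limit:
  assumes "large_N_family T k f"
  shows "\<exists>L. (\<lambda>m. rate_min T (k m) (f m)) \<longlonglongrightarrow> L \<and>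
    sqrt (1 / 2 + 1 / 12 * (2 - lambda_max T)) \<le> L \<and> (lambda_max T = 2 \<longrightarrow> L = 1 / sqrt 2)"
proof -
  have ok: "scft_ok T" and conf: "\<And>m. conformal T (k m) (f m)"
    using assms by (auto simp: large_N_family_def)
  obtain N x where N: "filterlim N at_top sequentially"
    and x: "\<And>i. i < nodes T \<Longrightarrow> 0 < x i \<and> (\<lambda>m. real (k m i) / N m) \<longlonglongrightarrow> x i"
    using assms unfolding large_N_family_def by metis
  show ?thesis
  proof (cases T)
    case (Quiver b g t t')
    interpret large_N_quiver b g t t' k f N x
      by unfold_locales (use ok conf N x Quiver in auto)
    let ?l = "lambda_max T"
    have "1 / 2 + 1 / 12 * (2 - ?l) \<le> 2 / 3 - Q / (24 * V)"
      using Q_le V_pos by (simp add: Quiver field_simps)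
    then have "sqrt (1 / 2 + 1 / 12 * (2 - ?l)) \<le> sqrt (2 / 3 - Q / (24 * V))"
      by (rule real_sqrt_le_mono)
    moreover have "sqrt (2 / 3 - Q / (24 * V)) = 1 / sqrt 2" if "?l = 2"
    proof -
      have "2 / 3 - Q / (24 * V) = 1 / 2"
        using Q_eq that V_pos by (simp add: Quiver)
      then show ?thesis by (simp only: sqrt_half)
    qed
    ultimately show ?thesis using rate_min_lim Quiver by blast
  next
    case (N4SYM h)
    then have "rate_min T (k m) (f m) = 1 / sqrt 2" for m
      using conf[of m] rate_min_N4SYM by simp
    then show ?thesis by (intro exI[of _ "1 / sqrt 2"]) (simp add: N4SYM sqrt_half)
  next
    case USpAlt
    \<comment> \<open>The rank itself tends to infinity: it is the ratio, with positive limit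
      \<open>x 0\<close>, times \<open>N\<close>, and \<open>N\<close> is eventually
      nonzero.\<close>
    have top: "filterlim (\<lambda>m. real (k m 0) / N m * N m) at_top sequentially"
      using x[of 0] N by (intro filterlim_tendsto_pos_mult_at_top[of _ "x 0"]) (auto simp: USpAlt)
    have eq: "\<forall>\<^sub>F m in sequentially. real (k m 0) / N m * N m = real (k m 0)"
      using N unfolding filterlim_at_top_dense by (rule allE[of _ 0]) (auto elim!: eventually_mono)
    have "filterlim (\<lambda>m. real (k m 0)) at_top sequentially"
      using filterlim_cong[OF refl refl eq, THEN iffD1, OF top] .
    with conf have "(\<lambda>m. rate_min T (k m) (f m)) \<longlonglongrightarrow> 1 / sqrt 2"
      unfolding USpAlt by (rule USpAlt_rate_min_lim)
    then show ?thesis by (intro exI[of _ "1 / sqrt 2"]) (simp add: USpAlt sqrt_half)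
  qed
qed

theorem mainTheorem3:
  fixes T :: scft and k f :: "nat \<Rightarrow> nat \<Rightarrow> nat"
  assumes "large_N_family T k f"
  shows
    "(\<forall>m. \<forall>i<nodes T. rate T (k m) (f m) i
        = rate_min T (k m) (f m) * sqrt (n_V T (k m) / gauge_dim (gauge_at T i) (k m i))) \<and>
     (\<exists>L. (\<lambda>m. rate_min T (k m) (f m)) \<longlonglongrightarrow> L \<and>
        L \<ge> sqrt (1 / 2 + 1 / 12 * (2 - lambda_max T)) \<and>
        sqrt (1 / 2 + 1 / 12 * (2 - lambda_max T)) \<ge> 1 / sqrt 2 \<and>
        (affine_scft T \<longrightarrow>
           L = sqrt (1 / 2 + 1 / 12 * (2 - lambda_max T)) \<and> L = 1 / sqrt 2) \<and>
        (\<not> affine_scft T \<longrightarrow> L > 1 / sqrt 2)) \<and>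
     lambda_max T \<le> 2 \<and>
     (\<forall>b. dynkin_ok b \<longrightarrow>
        (if affine_type b then largest_eigenvalue b = 2
         else largest_eigenvalue b = 2 * cos (pi / real (coxeter_number b)) \<and>
              largest_eigenvalue b < 2)) \<and>
     (\<forall>h n. gauge_ok h n \<longrightarrow> rate_min (N4SYM h) (\<lambda>_. n) (\<lambda>_. 0) = 1 / sqrt 2)"
proof -
  have ok: "scft_ok T" and conf: "\<And>m. conformal T (k m) (f m)"
    using assms by (auto simp: large_N_family_def)
  have le: "lambda_max T \<le> 2"
    using lambda_max_affine[OF ok] lambda_max_finite[OF ok] by fastforce
  obtain L where L: "(\<lambda>m. rate_min T (k m) (f m)) \<longlonglongrightarrow> L"
    "sqrt (1 / 2 + 1 / 12 * (2 - lambda_max T)) \<le> L" "lambda_max T = 2 \<longrightarrow> L = 1 / sqrt 2"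
    using rate_min_limit[OF assms] by blast
  have ge: "1 / sqrt 2 \<le> sqrt (1 / 2 + 1 / 12 * (2 - lambda_max T))"
    unfolding sqrt_half[symmetric] using le by (intro real_sqrt_le_mono) simp
  \<comment> \<open>Strictness survives the limit because it lies between constants: the lower bound
    on \<open>L\<close> already exceeds 1 / sqrt 2 when \<lambda> < 2.\<close>
  have "1 / sqrt 2 < L" if "\<not> affine_scft T"
  proof -
    have "1 / sqrt 2 < sqrt (1 / 2 + 1 / 12 * (2 - lambda_max T))"
      unfolding sqrt_half[symmetric] using lambda_max_finite[OF ok that]
      by (intro real_sqrt_less_mono) simp
    then show ?thesis using L(2) by linarith
  qed
  moreover have "L = sqrt (1 / 2 + 1 / 12 * (2 - lambda_max T)) \<and> L = 1 / sqrt 2" if "affine_scft T"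
    using L(3) lambda_max_affine[OF ok that] sqrt_half by simp
  ultimately have "(\<lambda>m. rate_min T (k m) (f m)) \<longlonglongrightarrow> L \<and>
        L \<ge> sqrt (1 / 2 + 1 / 12 * (2 - lambda_max T)) \<and>
        sqrt (1 / 2 + 1 / 12 * (2 - lambda_max T)) \<ge> 1 / sqrt 2 \<and>
        (affine_scft T \<longrightarrow>
           L = sqrt (1 / 2 + 1 / 12 * (2 - lambda_max T)) \<and> L = 1 / sqrt 2) \<and>
        (\<not> affine_scft T \<longrightarrow> L > 1 / sqrt 2)"
    using L(1,2) ge by blast
  moreover have "\<forall>m. \<forall>i<nodes T. rate T (k m) (f m) i
      = rate_min T (k m) (f m) * sqrt (n_V T (k m) / gauge_dim (gauge_at T i) (k m i))"
    using rate_eq n_V_pos[OF conf ok] by blast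
  moreover have "\<forall>h n. gauge_ok h n \<longrightarrow> rate_min (N4SYM h) (\<lambda>_. n) (\<lambda>_. 0) = 1 / sqrt 2"
    using rate_min_N4SYM by simp
  moreover have "\<forall>b. dynkin_ok b \<longrightarrow> (if affine_type b then largest_eigenvalue b = 2
      else largest_eigenvalue b = 2 * cos (pi / real (coxeter_number b)) \<and> largest_eigenvalue b < 2)"
    using largest_eigenvalue_cases by blast
  ultimately show ?thesis
    using le by (intro conjI) ((rule exI[of _ L])?, assumption)+
qed

end
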